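(* Let $\sigma$ be an irreducible incommensurable normalized multiscale substitution scheme in $\mathbb{R}^d$, and assume that there is a fixed $\eta>0$ such that every prototile $T_i\in\tau_\sigma$ satisfies $$\mathrm{vol}\big((\partial\,\mathrm{supp}\,F_t(T_i))^{+1}\big)=O\big(e^{(d-\eta)t}\big)\qquad (t\to\infty).$$ Then every $\mathcal{T}\in\mathbb{X}_\sigma^F$ is not uniformly spread.
   Context: Schemes. A tile in $\mathbb{R}^d$ is a bounded Lebesgue measurable set $T$ of positive measure $\mathrm{vol}\,T$ whose boundary has measure zero. A tessellation of $U\subset\mathbb{R}^d$ is a collection of tiles with pairwise disjoint interiors and union $U$; it is called a patch if $U$ is bounded ($U$ is then the support, $\mathrm{supp}$, of the patch) and a tiling if $U=\mathbb{R}^d$. A multiscale substitution scheme $\sigma=(\tau_\sigma,\varrho_\sigma)$ consists of a finite list of prototiles $\tau_\sigma=(T_1,\dots,T_n)$ and, for each $i$, a tessellation $\varrho_\sigma(T_i)$ of $T_i$ all of whose tiles are translates of rescaled prototiles $\alpha T_j$, with all $\alpha\in(0,1)$. A translate of $\alpha T_j$, $\alpha>0$, is a tile of type $j$ and scale $\alpha$. Standing assumptions: $\sigma$ is normalized, i.e. $\mathrm{vol}\,T_i=1$ for all $i$; distinct prototiles are geometrically different ($T_i$ is not a rescaled copy of $T_j$ for $i\ne j$), so the type of a tile is determined by the tile. Substitution semi-flow. For $t\ge 0$, $F_t(T_i)$ is the patch supported on $e^tT_i$ obtained by starting with $e^tT_i$ and repeatedly substituting (according to the rescaled rule $\varrho_\sigma$)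 every tile of volume $>1$, until all tiles have volume $\le 1$. $\sigma$ is irreducible if for all $i,j$ there is $t>0$ such that $F_t(T_i)$ contains a tile of type $j$. $\sigma$ is incommensurable if there are $i,j$ and $t_1,t_2>0$ with $t_1\notin\mathbb{Q}t_2$ such that $F_{t_1}(T_i)$ contains a tile of type $i$ and unit volume and $F_{t_2}(T_j)$ contains a tile of type $j$ and unit volume. Tiling space. Position each $T_i$ so that the origin is an interior point. Let $\mathscr{P}_\sigma=\{F_t(T_i): t\ge0,\ i=1,\dots,n\}$. Identify a patch or tiling with the closed set which is the union of the boundaries of its tiles. On closed subsets of $\mathbb{R}^d$ use the metric $D(A_1,A_2)=\inf(\{r>0: A_1\cap B(0,1/r)\subset A_2^{+r},\ A_2\cap B(0,1/r)\subset A_1^{+r}\}\cup\{1\})$, where $A^{+r}=\{x:\mathrm{dist}(x,A)\le r\}$ is the $r$-neighborhood of $A$ and $B(x,R)$ is the open Euclidean ball. $\mathbb{X}^F_\sigma$ is the set of all tilings $\mathcal{T}$ of $\mathbb{R}^d$ such that every sub-patch of $\mathcal{T}$ is a limit, with respect to $D$, of translated sub-patches of elements of $\mathscr{P}_\sigma$. Uniformly spread. A point set $Y\subset\mathbb{R}^d$ is uniformly spread if there are $\alpha>0$ and a bijection $\phi:Y\to\alpha\mathbb{Z}^d$ with $\sup_{y\in Y}\|y-\phi(y)\|<\infty$. A tiling $\mathcal{T}$ by tiles of uniformly bounded diameter is uniformly spread if some point set obtained by picking one point from each tile of $\mathcal{T}$ is uniformly spread (equivalently, every such point set is).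
   Formalization: Substitution rules are assumed finite; limits of patches are taken tile by tile with types preserved, not only for the unions of boundaries; and the points picked from distinct tiles must be distinct. Read literally, without these, the claim fails. *)

theory Defs
  imports "HOL-Analysis.Analysis" "HOL-Library.Landau_Symbols"
begin

abbreviation vol :: "(real^'d) set \<Rightarrow> real" where
  "vol S \<equiv> measure lebesgue S"

definition tile :: "(real^'d) set \<Rightarrow> bool" where
  "tile T \<longleftrightarrow> bounded T \<and> T \<in> sets lebesgue \<and> vol T > 0 \<and> emeasure lebesgue (frontier T) = 0"

text \<open>Two tiles with equal nonempty interior cannot both occur, so a set (rather than a family)
  of tiles loses nothing.\<close>

definition tessellation :: "(real^'d) set set \<Rightarrow> (real^'d) set \<Rightarrow> bool" where
  "tessellation P U \<longleftrightarrow>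
     (\<forall>S\<in>P. tile S) \<and> pairwise (\<lambda>S S'. interior S \<inter> interior S' = {}) P \<and> \<Union>P = U"

definition tiling :: "(real^'d) set set \<Rightarrow> bool" where
  "tiling P \<longleftrightarrow> tessellation P UNIV"

definition supp :: "(real^'d) set set \<Rightarrow> (real^'d) set" where
  "supp P = \<Union>P"

definition sub_patches :: "(real^'d) set set \<Rightarrow> (real^'d) set set set" where
  "sub_patches P = {Q. Q \<subseteq> P \<and> bounded (supp Q)}"

definition place :: "real^'d \<Rightarrow> real \<Rightarrow> (real^'d) set \<Rightarrow> (real^'d) set" where
  "place x \<alpha> S = (\<lambda>y. x + \<alpha> *\<^sub>R y) ` S"


section \<open>Multiscale substitution schemes\<close>

text \<open>\<open>rule \<sigma> i\<close> is the tessellation of the \<open>i\<close>-th prototile. Indices start at 0.\<close>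

record ('d::finite) scheme =
  prototiles :: "(real^'d) set list"
  rule :: "nat \<Rightarrow> (real^'d) set set"

abbreviation num_types :: "('d::finite) scheme \<Rightarrow> nat" where
  "num_types \<sigma> \<equiv> length (prototiles \<sigma>)"

definition tile_of :: "('d::finite) scheme \<Rightarrow> nat \<Rightarrow> real \<Rightarrow> (real^'d) set \<Rightarrow> bool" where
  "tile_of \<sigma> j \<alpha> S \<longleftrightarrow>
     j < num_types \<sigma> \<and> \<alpha> > 0 \<and> (\<exists>x. S = place x \<alpha> (prototiles \<sigma> ! j))"

definition has_type :: "('d::finite) scheme \<Rightarrow> nat \<Rightarrow> (real^'d) set \<Rightarrow> bool" where
  "has_type \<sigma> j S \<longleftrightarrow> (\<exists>\<alpha>. tile_of \<sigma> j \<alpha> S)"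

text \<open>The last two clauses are standing conventions: distinct prototiles are not copies of each
  other, and the origin is an interior point of every prototile. A rule consists of finitely many
  tiles. This finiteness is what makes the union of the tile boundaries of a patch
  \<^term>\<open>semiflow \<sigma> t i\<close>, defined below, a closed set.\<close>

definition multiscale_scheme :: "('d::finite) scheme \<Rightarrow> bool" where
  "multiscale_scheme \<sigma> \<longleftrightarrow>
     (\<forall>i<num_types \<sigma>. tile (prototiles \<sigma> ! i)) \<and>
     (\<forall>i<num_types \<sigma>. finite (rule \<sigma> i) \<and> tessellation (rule \<sigma> i) (prototiles \<sigma> ! i) \<and>
        (\<forall>S\<in>rule \<sigma> i. \<exists>j \<alpha>. \<alpha> < 1 \<and> tile_of \<sigma> j \<alpha> S)) \<and>
     (\<forall>i<num_types \<sigma>. \<forall>j<num_types \<sigma>. i \<noteq> j \<longrightarrow> \<not> has_type \<sigma> j (prototiles \<sigma> ! i)) \<and>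
     (\<forall>i<num_types \<sigma>. 0 \<in> interior (prototiles \<sigma> ! i))"

definition normalized :: "('d::finite) scheme \<Rightarrow> bool" where
  "normalized \<sigma> \<longleftrightarrow> (\<forall>i<num_types \<sigma>. vol (prototiles \<sigma> ! i) = 1)"


section \<open>The substitution semi-flow\<close>

text \<open>The rescaled rule applied to a tile. The triple \<open>(j, x, \<alpha>)\<close> is determined by the tile.\<close>

definition substitute :: "('d::finite) scheme \<Rightarrow> (real^'d) set \<Rightarrow> (real^'d) set set" where
  "substitute \<sigma> S =
     {place x \<alpha> V | j x \<alpha> V. j < num_types \<sigma> \<and> \<alpha> > 0 \<and>
        S = place x \<alpha> (prototiles \<sigma> ! j) \<and> V \<in> rule \<sigma> j}"

text \<open>All tiles that occur at some stage of the repeated substitution of \<open>e\<^sup>t T\<^sub>i\<close>. Those of volume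
  at most 1 are never substituted again, hence they are the tiles of the final patch.\<close>

inductive_set stages :: "('d::finite) scheme \<Rightarrow> real \<Rightarrow> nat \<Rightarrow> (real^'d) set set"
  for \<sigma> :: "('d::finite) scheme" and t :: real and i :: nat where
  start: "place 0 (exp t) (prototiles \<sigma> ! i) \<in> stages \<sigma> t i"
| subst: "S \<in> stages \<sigma> t i \<Longrightarrow> vol S > 1 \<Longrightarrow> U \<in> substitute \<sigma> S \<Longrightarrow> U \<in> stages \<sigma> t i"

definition semiflow :: "('d::finite) scheme \<Rightarrow> real \<Rightarrow> nat \<Rightarrow> (real^'d) set set" where
  "semiflow \<sigma> t i = {S \<in> stages \<sigma> t i. vol S \<le> 1}"

definition irreducible_scheme :: "('d::finite) scheme \<Rightarrow> bool" where
  "irreducible_scheme \<sigma> \<longleftrightarrow>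
     (\<forall>i<num_types \<sigma>. \<forall>j<num_types \<sigma>. \<exists>t>0. \<exists>S\<in>semiflow \<sigma> t i. has_type \<sigma> j S)"

definition incommensurable_scheme :: "('d::finite) scheme \<Rightarrow> bool" where
  "incommensurable_scheme \<sigma> \<longleftrightarrow>
     (\<exists>i<num_types \<sigma>. \<exists>j<num_types \<sigma>. \<exists>t\<^sub>1>0. \<exists>t\<^sub>2>0.
        \<not> (\<exists>q\<in>\<rat>. t\<^sub>1 = q * t\<^sub>2) \<and>
        (\<exists>S\<in>semiflow \<sigma> t\<^sub>1 i. has_type \<sigma> i S \<and> vol S = 1) \<and>
        (\<exists>S\<in>semiflow \<sigma> t\<^sub>2 j. has_type \<sigma> j S \<and> vol S = 1))"


section \<open>The tiling space\<close>

text \<open>The distance to the empty set is infinite in the mathematics, but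
  \<^term>\<open>infdist x {} = 0\<close>.\<close>

definition neighborhood :: "real \<Rightarrow> (real^'d) set \<Rightarrow> (real^'d) set" where
  "neighborhood r A = {x. A \<noteq> {} \<and> infdist x A \<le> r}"

definition D :: "(real^'d) set \<Rightarrow> (real^'d) set \<Rightarrow> real" where
  "D A B = Inf ({r. r > 0 \<and> A \<inter> ball 0 (1/r) \<subseteq> neighborhood r B \<and>
                       B \<inter> ball 0 (1/r) \<subseteq> neighborhood r A} \<union> {1})"

definition boundary_set :: "(real^'d) set set \<Rightarrow> (real^'d) set" where
  "boundary_set P = (\<Union>S\<in>P. frontier S)"

definition generating_patches :: "('d::finite) scheme \<Rightarrow> (real^'d) set set set" where
  "generating_patches \<sigma> = {semiflow \<sigma> t i | t i. t \<ge> 0 \<and> i < num_types \<sigma>}"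

definition translated_sub_patches :: "('d::finite) scheme \<Rightarrow> (real^'d) set set set" where
  "translated_sub_patches \<sigma> =
     {(\<lambda>S. (+) v ` S) ` Q | v Q P. P \<in> generating_patches \<sigma> \<and> Q \<in> sub_patches P}"

text \<open>Limits of patches with respect to \<^const>\<open>D\<close>. A patch is identified with its boundary set, but
  still consists of tiles of definite types, which the boundary set alone need not determine. If
  \<open>T\<^sub>1 = [0,1)\<close> and \<open>T\<^sub>2 = [0,1/2) \<union> [2,5/2)\<close> are prototiles on the line, two type 1 tiles of equal
  length and suitable distance have the same boundary set as one type 2 tile; merging such pairs in
  a tiling changes the number of tiles, but not the boundary set of any sub-patch. The
  identification is therefore read as keeping track of the tiles: those of the approximating
  patches correspond to those of the limit, with the same types, and convergence in
  \<^const>\<open>D\<close> holds for the patches and for their corresponding sub-patches.\<close>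

definition patch_limit ::
  "('d::finite) scheme \<Rightarrow> (nat \<Rightarrow> (real^'d) set set) \<Rightarrow> (real^'d) set set \<Rightarrow> bool" where
  "patch_limit \<sigma> A P \<longleftrightarrow>
     (\<exists>b. (\<forall>k. bij_betw (b k) P (A k) \<and>
               (\<forall>S\<in>P. \<forall>j. has_type \<sigma> j (b k S) \<longleftrightarrow> has_type \<sigma> j S)) \<and>
          (\<forall>Q\<subseteq>P. (\<lambda>k. D (boundary_set (b k ` Q)) (boundary_set Q)) \<longlonglongrightarrow> 0))"

lemma patch_limit_imp_D_limit:
  assumes "patch_limit \<sigma> A P"
  shows "(\<lambda>k. D (boundary_set (A k)) (boundary_set P)) \<longlonglongrightarrow> 0"
proof -
  obtain b where b: "\<forall>k. bij_betw (b k) P (A k) \<and>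
               (\<forall>S\<in>P. \<forall>j. has_type \<sigma> j (b k S) \<longleftrightarrow> has_type \<sigma> j S)"
    and lim: "\<forall>Q\<subseteq>P. (\<lambda>k. D (boundary_set (b k ` Q)) (boundary_set Q)) \<longlonglongrightarrow> 0"
    using assms unfolding patch_limit_def by (elim exE conjE)
  have "b k ` P = A k" for k
    using b by (simp add: bij_betw_def)
  then show ?thesis
    using lim[rule_format, OF subset_refl] by simp
qed

definition tiling_space :: "('d::finite) scheme \<Rightarrow> (real^'d) set set set" where
  "tiling_space \<sigma> =
     {\<T>. tiling \<T> \<and>
        (\<forall>P\<in>sub_patches \<T>. \<exists>A. (\<forall>k. A k \<in> translated_sub_patches \<sigma>) \<and> patch_limit \<sigma> A P)}"


section \<open>Uniformly spread point sets and tilings\<close>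

definition scaled_lattice :: "real \<Rightarrow> (real^'d) set" where
  "scaled_lattice \<alpha> = {\<alpha> *\<^sub>R z | z. \<forall>i. z $ i \<in> \<int>}"

definition uniformly_spread :: "(real^'d) set \<Rightarrow> bool" where
  "uniformly_spread Y \<longleftrightarrow>
     (\<exists>\<alpha>>0. \<exists>\<phi>. bij_betw \<phi> Y (scaled_lattice \<alpha>) \<and> bdd_above ((\<lambda>y. norm (y - \<phi> y)) ` Y))"

text \<open>Tiles may share boundary points. Injectivity of the choice keeps the points of different
  tiles apart; without it the property would depend on the choice of points.\<close>

definition uniformly_spread_tiling :: "(real^'d) set set \<Rightarrow> bool" where
  "uniformly_spread_tiling \<T> \<longleftrightarrow>
     (\<exists>f. (\<forall>S\<in>\<T>. f S \<in> S) \<and> inj_on f \<T> \<and> uniformly_spread (f ` \<T>))"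

end

theory Submission
  imports Defs "HOL-Real_Asymp.Real_Asymp"
begin

text \<open>Write \<open>N\<^sub>j(t)\<close> for the number of tiles of \<open>F\<^sub>t(T\<^sub>j)\<close> and \<open>d\<close> for the dimension.

  Suppose that a tiling in the tiling space is uniformly spread, so that its tiles are matched with
  the points of \<open>\<alpha>\<int>\<^sup>d\<close> at bounded distance, and let \<open>c = \<alpha>\<^sup>-\<^sup>d\<close>. A large ball of the tiling is close to a
  large ball of some generating patch (\<open>approximating_patch\<close>). Stopping the substitution of that patch
  at an intermediate scale exhibits inflated tiles inside the ball, and each inflated tile
  \<open>e\<^sup>t T\<^sub>j\<close> is subdivided into a copy of \<open>F\<^sub>t(T\<^sub>j)\<close>. The matching is inherited by this copy, so
  \<open>N\<^sub>j(t)\<close> differs from \<open>c e\<^sup>d\<^sup>t\<close> by at most a constant times the volume of a neighbourhood of the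
  boundary of \<open>e\<^sup>t T\<^sub>j\<close> (\<open>count_near_volume\<close>), and the boundary hypothesis bounds this by
  \<open>O(exp((d - \<eta>)t))\<close>. Which \<open>t\<close> occur is decided by the lengths of the substitution paths that end in
  type \<open>j\<close>. Irreducibility and incommensurability make these lengths eventually dense
  (\<open>eventually_dense_paths\<close>), so the estimate holds for a dense set of \<open>t\<close>; as \<open>N\<^sub>j\<close> is a
  step function that is continuous from the left, it holds for all large \<open>t\<close>
  (\<open>left_limit_of_estimate\<close>).

  Such an estimate is impossible by the pigeonhole principle (\<open>sparse_jumps_force_large_error\<close>).
  The function \<open>N\<^sub>j\<close> can only jump at lengths of substitution paths. These are sums of finitely many
  edge lengths, so there are only polynomially many of them in \<open>[0,t]\<close>. On an interval of length one
  \<open>N\<^sub>j\<close> grows by an amount of order \<open>e\<^sup>d\<^sup>t\<close>, hence one of its jumps is at least \<open>e\<^sup>d\<^sup>t\<close> divided by a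
  polynomial in \<open>t\<close>. The main term \<open>c e\<^sup>d\<^sup>t\<close> is continuous, so the error term has to absorb the whole
  jump, which is too large for \<open>O(exp((d - \<eta>)t))\<close>.\<close>

section \<open>Integer combinations and finite sums\<close>

text \<open>The number \<open>\<delta> = p a - q b\<close> is the size of a small step: exchanging \<open>q\<close> copies of \<open>b\<close> for \<open>p\<close> copies
  of \<open>a\<close> increases a combination by \<open>\<delta>\<close>. Starting from at least \<open>K q\<close> copies of \<open>b\<close> one can make \<open>K\<close>
  such steps, and \<open>K \<delta> > b\<close> lets them bridge the gap between consecutive multiples of \<open>b\<close>.\<close>
lemma integer_combinations_step:
  fixes a b \<epsilon> :: real and p q :: nat
  assumes a: "a > 0" and b: "b > 0"
    and pq: "real p * a - real q * b > 0" "real p * a - real q * b < \<epsilon>"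
  shows "\<exists>L0. \<forall>L\<ge>L0. \<exists>n m. L < real n * a + real m * b \<and> real n * a + real m * b < L + \<epsilon>"
proof -
  define \<delta> where "\<delta> = real p * a - real q * b"
  obtain K :: nat where K: "real K * \<delta> > b"
    using reals_Archimedean3[of \<delta>] pq \<delta>_def by metis
  show ?thesis
  proof (intro exI[of _ "real K * real q * b"] allI impI)
    fix L assume L: "L \<ge> real K * real q * b"
    \<comment> \<open>first approach \<open>L\<close> from below by multiples of \<open>b\<close>, then make \<open>k\<close> steps to just exceed it\<close>
    define m where "m = nat \<lfloor>(L - real K * real q * b) / b\<rfloor>"
    have m: "real m = of_int \<lfloor>(L - real K * real q * b) / b\<rfloor>"
      using L b by (simp add: m_def)
    have m1: "real m * b \<le> L - real K * real q * b"
      using of_int_floor_le[of "(L - real K * real q * b) / b"] b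
      unfolding m by (metis pos_le_divide_eq)
    have m2: "L - real K * real q * b < real m * b + b"
      using floor_correct[of "(L - real K * real q * b) / b"] b
      by (simp add: m pos_divide_less_eq algebra_simps)
    define r where "r = L - real K * real q * b - real m * b"
    have r: "0 \<le> r" "r < b" using m1 m2 by (auto simp: r_def)
    define k where "k = nat (\<lfloor>r / \<delta>\<rfloor> + 1)"
    have dpos: "\<delta> > 0" "\<delta> < \<epsilon>" using pq by (auto simp: \<delta>_def)
    have k: "real k = of_int \<lfloor>r / \<delta>\<rfloor> + 1"
      using r dpos by (simp add: k_def)
    have k1: "real k * \<delta> > r"
      using floor_correct[of "r / \<delta>"] dpos(1) unfolding k by (metis pos_divide_less_eq of_int_1 of_int_add)
    have k2: "(real k - 1) * \<delta> \<le> r"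
      using of_int_floor_le[of "r / \<delta>"] dpos(1) unfolding k by (metis pos_le_divide_eq add_diff_cancel_right')
    have "(real k - 1) * \<delta> < real K * \<delta>" using k2 r K by linarith
    then have "k \<le> K" using dpos by (simp add: mult_less_cancel_right)
    then have "real (K - k) = real K - real k" by simp
    then have "real (k * p) * a + real ((K - k) * q + m) * b =
        real k * real p * a + ((real K - real k) * real q + real m) * b" by (simp only: of_nat_add of_nat_mult)
    also have "\<dots> = L + (real k * \<delta> - r)"
      unfolding r_def \<delta>_def by (simp add: algebra_simps)
    finally have eq: "real (k * p) * a + real ((K - k) * q + m) * b = L + (real k * \<delta> - r)" .
    have "0 < real k * \<delta> - r" using k1 by simp
    moreover have "real k * \<delta> - r < \<epsilon>" using k2 dpos by (simp add: algebra_simps)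
    ultimately show "\<exists>n m. L < real n * a + real m * b \<and> real n * a + real m * b < L + \<epsilon>"
      using eq by (metis add.commute add_less_cancel_left less_add_same_cancel2)
  qed
qed

text \<open>Dirichlet's approximation theorem for \<open>a/b\<close> gives a step as in the previous lemma; its sign decides
  which of \<open>a\<close> and \<open>b\<close> is exchanged for the other, and it is nonzero because \<open>a/b\<close> is irrational.\<close>
lemma integer_combinations_eventually_dense:
  fixes a b \<epsilon> :: real
  assumes a: "a > 0" and b: "b > 0" and irr: "\<not> (\<exists>q\<in>\<rat>. a = q * b)" and e: "\<epsilon> > 0"
  shows "\<exists>L0. \<forall>L\<ge>L0. \<exists>n m. L < real n * a + real m * b \<and> real n * a + real m * b < L + \<epsilon>"
proof -
  obtain N :: nat where N: "N > 0" "b / real N < \<epsilon>" 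
  proof -
    obtain N0 :: nat where "real N0 * \<epsilon> > b" using reals_Archimedean3[OF e] by blast
    moreover have "N0 > 0" using calculation b by (cases N0) auto
    ultimately show ?thesis using that[of N0] by (simp add: pos_divide_less_eq mult.commute)
  qed
  obtain h k where hk: "0 < k" "\<bar>of_int k * (a / b) - of_int h\<bar> < 1 / real N"
    using Dirichlet_approx[OF N(1), of "a / b"] by metis
  define x where "x = of_int k * a - of_int h * b"
  have "\<bar>x\<bar> = \<bar>of_int k * (a / b) - of_int h\<bar> * b"
  proof -
    have "x = (of_int k * (a / b) - of_int h) * b" using b by (simp add: x_def left_diff_distrib)
    then show ?thesis using b by (simp add: abs_mult)
  qed
  also have "\<dots> < 1 / real N * b" using hk b by (intro mult_strict_right_mono) auto
  finally have xb: "\<bar>x\<bar> < b / real N" by simp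
  then have xe: "\<bar>x\<bar> < \<epsilon>" using N(2) by linarith
  have "x \<noteq> 0"
  proof
    assume "x = 0"
    then have "a = (of_int h / of_int k) * b" using hk by (simp add: x_def field_simps)
    moreover have "of_int h / of_int k \<in> (\<rat> :: real set)" by simp
    ultimately show False using irr by blast
  qed
  have "b / real N \<le> b" using N b by (simp add: pos_divide_le_eq mult_le_cancel_left1)
  then have "x < b" using xb by linarith
  moreover have "of_int k * a > 0" using hk a by simp
  ultimately have "- b < of_int h * b" unfolding x_def by linarith
  then have "-1 * b < of_int h * b" by simp
  then have "-1 < (of_int h :: real)" using b by (simp only: mult_less_cancel_right_pos)
  then have h0: "h \<ge> 0" by linarith
  have k': "real (nat k) = of_int k" and h': "real (nat h) = of_int h" using hk h0 by auto
  show ?thesis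
  proof (cases "x > 0")
    case True
    then show ?thesis
      using integer_combinations_step[OF a b, of "nat k" "nat h" \<epsilon>] xe k' h' by (simp add: x_def)
  next
    case False
    with \<open>x \<noteq> 0\<close> have "x < 0" by simp
    then have "\<exists>L0. \<forall>L\<ge>L0. \<exists>n m. L < real n * b + real m * a \<and> real n * b + real m * a < L + \<epsilon>"
      using integer_combinations_step[OF b a, of "nat h" "nat k" \<epsilon>] xe k' h' by (simp add: x_def)
    then show ?thesis by (metis add.commute)
  qed
qed

inductive_set finite_sums :: "real set \<Rightarrow> real set" for \<Lambda> where
  zero: "0 \<in> finite_sums \<Lambda>"
| add: "x \<in> finite_sums \<Lambda> \<Longrightarrow> l \<in> \<Lambda> \<Longrightarrow> x + l \<in> finite_sums \<Lambda>"

lemma finite_sums_add_left: "x \<in> finite_sums A \<Longrightarrow> l \<in> A \<Longrightarrow> l + x \<in> finite_sums A"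
  using finite_sums.add[of x A l] by (simp add: add.commute)

lemma finite_sums_multiplicities:
  assumes "x \<in> finite_sums \<Lambda>" "finite \<Lambda>"
  shows "\<exists>n :: real \<Rightarrow> nat. x = (\<Sum>l\<in>\<Lambda>. real (n l) * l)"
  using assms
proof (induction rule: finite_sums.induct)
  case zero
  show ?case by (rule exI[of _ "\<lambda>_. 0"]) simp
next
  case (add x l)
  then obtain n where n: "x = (\<Sum>l\<in>\<Lambda>. real (n l) * l)" by blast
  have "(\<Sum>k\<in>\<Lambda>. real ((n(l := n l + 1)) k) * k) = (\<Sum>k\<in>\<Lambda>. real (n k) * k + (if k = l then l else 0))"
    by (rule sum.cong) (auto simp: algebra_simps)
  also have "\<dots> = x + l"
    using add by (simp add: sum.distrib n)
  finally show ?case by metis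
qed

text \<open>A sum is determined by the multiplicities of its summands, and each multiplicity is at most \<open>t\<close>
  divided by the least summand. The exponent \<open>E\<close> is the number of different summands.\<close>
lemma finite_sums_polynomial_growth:
  assumes fin: "finite \<Lambda>" and pos: "\<And>l. l \<in> \<Lambda> \<Longrightarrow> l > 0"
  shows "\<exists>C E. \<forall>t\<ge>0. finite (finite_sums \<Lambda> \<inter> {..t}) \<and>
           real (card (finite_sums \<Lambda> \<inter> {..t})) \<le> (C * (1 + t)) ^ E"
proof -
  obtain l0 where l0: "l0 > 0" "\<And>l. l \<in> \<Lambda> \<Longrightarrow> l0 \<le> l"
  proof (cases "\<Lambda> = {}")
    case True
    then show ?thesis using that[of 1] by simp
  next
    case False
    then show ?thesis using that[of "Min \<Lambda>"] fin pos by simp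
  qed
  define C where "C = 1 + 1 / l0"
  have main: "finite (finite_sums \<Lambda> \<inter> {..t}) \<and>
           real (card (finite_sums \<Lambda> \<inter> {..t})) \<le> (C * (1 + t)) ^ card \<Lambda>" if t: "t \<ge> 0" for t
  proof -
    define m where "m = nat \<lfloor>t / l0\<rfloor>"
    define F where "F = (\<Lambda> \<rightarrow>\<^sub>E {..m})"
    have finF: "finite F" using fin by (simp add: F_def finite_PiE)
    have sub: "finite_sums \<Lambda> \<inter> {..t} \<subseteq> (\<lambda>n. \<Sum>l\<in>\<Lambda>. real (n l) * l) ` F"
    proof
      fix x assume x: "x \<in> finite_sums \<Lambda> \<inter> {..t}"
      then obtain n :: "real \<Rightarrow> nat" where n: "x = (\<Sum>l\<in>\<Lambda>. real (n l) * l)"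
        using finite_sums_multiplicities fin by blast
      have "n l \<le> m" if l: "l \<in> \<Lambda>" for l
      proof -
        have "real (n l) * l0 \<le> real (n l) * l" using l0 l by (simp add: mult_left_mono)
        also have "\<dots> \<le> x" unfolding n
          using l fin pos by (intro member_le_sum) (auto simp: less_imp_le)
        also have "\<dots> \<le> t" using x by simp
        finally have "real (n l) \<le> t / l0" using l0 by (simp add: pos_le_divide_eq)
        then show ?thesis unfolding m_def by (simp add: le_nat_iff le_floor_iff)
      qed
      then have "restrict n \<Lambda> \<in> F" by (auto simp: F_def)
      moreover have "x = (\<Sum>l\<in>\<Lambda>. real (restrict n \<Lambda> l) * l)" unfolding n by (rule sum.cong) auto
      ultimately show "x \<in> (\<lambda>n. \<Sum>l\<in>\<Lambda>. real (n l) * l) ` F" by blast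
    qed
    have "card (finite_sums \<Lambda> \<inter> {..t}) \<le> card F"
      using sub finF by (meson card_image_le card_mono finite_imageI le_trans)
    also have "card F = (m + 1) ^ card \<Lambda>" unfolding F_def using fin by (simp add: card_PiE)
    finally have c: "real (card (finite_sums \<Lambda> \<inter> {..t})) \<le> (real m + 1) ^ card \<Lambda>"
      by (metis of_nat_1 of_nat_add of_nat_le_iff of_nat_power)
    have "real m \<le> t / l0" using t l0 by (simp add: m_def)
    also have "t / l0 + 1 \<le> C * (1 + t)" using t l0 by (simp add: C_def field_simps)
    finally have "real m + 1 \<le> C * (1 + t)" by simp
    then have "(real m + 1) ^ card \<Lambda> \<le> (C * (1 + t)) ^ card \<Lambda>" by (intro power_mono) auto
    then show ?thesis using c finite_subset[OF sub] finF by auto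
  qed
  then show ?thesis by blast
qed

text \<open>Across each of its jumps \<open>N\<close> grows by at most \<open>2 B\<close>: just after the jump \<open>N\<close> is within \<open>B\<close> of
  the continuous function \<open>g\<close>, and so it is at the jump. The first assumption makes \<open>N\<close> continuous from
  the left, since a point of \<open>J\<close> only affects the values to its right.\<close>
lemma step_function_jump_bound:
  fixes N g :: "real \<Rightarrow> real"
  assumes const: "\<And>s t. s \<le> t \<Longrightarrow> J \<inter> {s..<t} = {} \<Longrightarrow> N s = N t"
    and close: "\<And>s. a \<le> s \<Longrightarrow> s \<le> b \<Longrightarrow> \<bar>N s - g s\<bar> \<le> B"
    and cont: "continuous_on UNIV g"
    and ab: "a \<le> b" and fin: "finite (J \<inter> {a..<b})"
  shows "N b - N a \<le> 2 * B * real (card (J \<inter> {a..<b}))"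
  using close ab fin
proof (induction "card (J \<inter> {a..<b})" arbitrary: b)
  case 0
  then have "J \<inter> {a..<b} = {}" by simp
  then show ?case using const[OF \<open>a \<le> b\<close>] 0 by simp
next
  case (Suc k)
  define l where "l = Max (J \<inter> {a..<b})"
  have ne: "J \<inter> {a..<b} \<noteq> {}" using Suc.hyps by auto
  have l: "l \<in> J" "a \<le> l" "l < b"
    using Max_in[OF Suc.prems(3) ne] by (auto simp: l_def)
  have mx: "x \<le> l" if "x \<in> J" "a \<le> x" "x < b" for x
    using Max_ge[OF Suc.prems(3)] that by (auto simp: l_def)
  have eq: "J \<inter> {a..<b} = insert l (J \<inter> {a..<l})"
  proof (intro set_eqI iffI)
    fix x assume "x \<in> J \<inter> {a..<b}"
    with mx[of x] show "x \<in> insert l (J \<inter> {a..<l})" by (cases "x = l") auto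
  next
    fix x assume "x \<in> insert l (J \<inter> {a..<l})"
    then show "x \<in> J \<inter> {a..<b}" using l by auto
  qed
  have fin': "finite (J \<inter> {a..<l})" using Suc.prems(3) eq by (metis finite_insert)
  then have card: "card (J \<inter> {a..<b}) = Suc (card (J \<inter> {a..<l}))" unfolding eq by simp
  then have IH: "N l - N a \<le> 2 * B * real (card (J \<inter> {a..<l}))"
    using Suc.hyps l fin' Suc.prems by (intro Suc.hyps(1)) auto
  have lim: "(g \<longlongrightarrow> g l) (at_right l)"
    using cont by (auto simp: continuous_on_def intro: tendsto_within_subset)
  have ev: "\<forall>\<^sub>F y in at_right l. N b - B \<le> g y"
  proof -
    have "\<forall>\<^sub>F y in at_right l. y \<in> {l<..<b}"
      using l by (simp add: eventually_at_right_field) (use l in blast)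
    then show ?thesis
    proof eventually_elim
      case (elim y)
      have "J \<inter> {y..<b} = {}"
      proof (rule ccontr)
        assume "J \<inter> {y..<b} \<noteq> {}"
        then obtain x where "x \<in> J" "y \<le> x" "x < b" by auto
        then show False using mx[of x] elim l by auto
      qed
      then have "N y = N b" using const elim by simp
      moreover have "\<bar>N y - g y\<bar> \<le> B" using elim l Suc.prems(1) by simp
      ultimately show ?case by linarith
    qed
  qed
  have "N b - B \<le> g l"
    by (rule tendsto_lowerbound[OF lim ev]) simp
  moreover have "\<bar>N l - g l\<bar> \<le> B" using l Suc.prems by simp
  ultimately have "N b - N l \<le> 2 * B" by linarith
  with IH show ?case unfolding card by (simp add: algebra_simps)
qed

text \<open>The pigeonhole argument: on \<open>[t, t + 1]\<close> the function \<open>N\<close> grows by about \<open>c (e\<^sup>d - 1) e\<^sup>d\<^sup>t\<close>, but it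
  has only polynomially many jumps there, each of size \<open>O(exp((d - \<eta>)t))\<close>.\<close>
lemma sparse_jumps_force_large_error:
  fixes N :: "real \<Rightarrow> real" and d :: real
  assumes const: "\<And>s t. s \<le> t \<Longrightarrow> J \<inter> {s..<t} = {} \<Longrightarrow> N s = N t"
    and card: "\<And>t. t \<ge> 0 \<Longrightarrow> finite (J \<inter> {..t}) \<and> real (card (J \<inter> {..t})) \<le> (C * (1 + t)) ^ E"
    and close: "\<And>t. t \<ge> t0 \<Longrightarrow> \<bar>N t - c * exp (d * t)\<bar> \<le> K * exp ((d - \<eta>) * t)"
    and pos: "c > 0" "d > 0" "\<eta> > 0"
  shows False
proof -
  define K' where "K' = \<bar>K\<bar> * exp \<bar>d - \<eta>\<bar>"
  have bound: "c * (exp d - 1) \<le> exp (- \<eta> * t) * (2 * K' + 2 * K' * (C * (2 + t)) ^ E)"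
    if t: "t \<ge> t0" "t \<ge> 0" for t
  proof -
    define B where "B = K' * exp ((d - \<eta>) * t)"
    have B0: "B \<ge> 0" by (simp add: B_def K'_def)
    have close': "\<bar>N s - c * exp (d * s)\<bar> \<le> B" if s: "t \<le> s" "s \<le> t + 1" for s
    proof -
      have "(d - \<eta>) * s = (d - \<eta>) * t + (d - \<eta>) * (s - t)" by (simp add: algebra_simps)
      also have "(d - \<eta>) * (s - t) \<le> \<bar>d - \<eta>\<bar>"
      proof -
        have "(d - \<eta>) * (s - t) \<le> \<bar>d - \<eta>\<bar> * (s - t)"
          using s by (intro mult_right_mono abs_ge_self) auto
        also have "\<dots> \<le> \<bar>d - \<eta>\<bar>" using s by (intro mult_left_le) auto
        finally show ?thesis .
      qed
      finally have "exp ((d - \<eta>) * s) \<le> exp ((d - \<eta>) * t + \<bar>d - \<eta>\<bar>)"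
        by (simp only: exp_le_cancel_iff add_le_cancel_left)
      then have "exp ((d - \<eta>) * s) \<le> exp \<bar>d - \<eta>\<bar> * exp ((d - \<eta>) * t)"
        by (simp only: exp_add mult.commute)
      then have "\<bar>K\<bar> * exp ((d - \<eta>) * s) \<le> B" unfolding B_def K'_def
        by (simp add: mult.assoc mult_left_mono)
      moreover have "K * exp ((d - \<eta>) * s) \<le> \<bar>K\<bar> * exp ((d - \<eta>) * s)" by (simp add: mult_right_mono)
      ultimately show ?thesis using close[of s] s t by linarith
    qed
    have cardJ: "finite (J \<inter> {..t+1})" "real (card (J \<inter> {..t+1})) \<le> (C * (2 + t)) ^ E"
      using card[of "t + 1"] t by (auto simp: algebra_simps)
    have sub: "J \<inter> {t..<t+1} \<subseteq> J \<inter> {..t+1}" by auto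
    have "N (t + 1) - N t \<le> 2 * B * real (card (J \<inter> {t..<t+1}))"
      using finite_subset[OF sub cardJ(1)] close'
      by (intro step_function_jump_bound[where g = "\<lambda>s. c * exp (d * s)"] const)
        (auto intro!: continuous_intros)
    also have "\<dots> \<le> 2 * B * (C * (2 + t)) ^ E"
      using card_mono[OF cardJ(1) sub] cardJ(2) B0 by (intro mult_left_mono) auto
    finally have up: "N (t + 1) - N t \<le> 2 * B * (C * (2 + t)) ^ E" .
    have "N (t + 1) - N t \<ge> c * exp (d * (t + 1)) - c * exp (d * t) - 2 * B"
      using close'[of t] close'[of "t + 1"] by linarith
    then have low: "c * (exp (d * t) * exp d) - c * exp (d * t) - 2 * B \<le> N (t + 1) - N t"
      by (simp add: distrib_left exp_add)
    have B: "B = exp (d * t) * (exp (- \<eta> * t) * K')"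
      by (simp add: B_def left_diff_distrib exp_diff exp_minus divide_inverse)
    have "exp (d * t) * (c * (exp d - 1)) = c * (exp (d * t) * exp d) - c * exp (d * t)"
      by (simp add: right_diff_distrib)
    also have "\<dots> \<le> 2 * B + 2 * B * (C * (2 + t)) ^ E"
      using low up by linarith
    also have "\<dots> = exp (d * t) * (exp (- \<eta> * t) * (2 * K' + 2 * K' * (C * (2 + t)) ^ E))"
      unfolding B by (simp only: distrib_left mult_ac)
    finally have "exp (d * t) * (c * (exp d - 1)) \<le>
        exp (d * t) * (exp (- \<eta> * t) * (2 * K' + 2 * K' * (C * (2 + t)) ^ E))" .
    then show ?thesis by simp
  qed
  have "((\<lambda>t. exp (- \<eta> * t) * (2 * K' + 2 * K' * (C * (2 + t)) ^ E)) \<longlongrightarrow> 0) at_top"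
  proof -
    have 1: "((\<lambda>t. exp (- \<eta> * t)) \<longlongrightarrow> 0) at_top" using pos by real_asymp
    have 2: "((\<lambda>t. exp (- \<eta> * t) * (2 + t) ^ E) \<longlongrightarrow> 0) at_top" using pos by real_asymp
    have "((\<lambda>t. 2 * K' * exp (- \<eta> * t) + 2 * K' * C ^ E * (exp (- \<eta> * t) * (2 + t) ^ E)) \<longlongrightarrow>
        2 * K' * 0 + 2 * K' * C ^ E * 0) at_top"
      by (intro tendsto_intros 1 2)
    then show ?thesis unfolding power_mult_distrib by (simp add: distrib_left mult_ac)
  qed
  then have "c * (exp d - 1) \<le> 0"
  proof (rule tendsto_lowerbound)
    show "\<forall>\<^sub>F t in at_top. c * (exp d - 1) \<le> exp (- \<eta> * t) * (2 * K' + 2 * K' * (C * (2 + t)) ^ E)"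
      using eventually_ge_at_top[of "max t0 0"] by eventually_elim (use bound in auto)
  qed simp
  then show False using pos by (simp add: mult_le_0_iff)
qed

section \<open>Homothetic copies of sets and tiles\<close>

lemma place_place: "place x \<alpha> (place y \<beta> S) = place (x + \<alpha> *\<^sub>R y) (\<alpha> * \<beta>) S"
  by (auto simp: place_def image_image algebra_simps)

lemma place_id [simp]: "place 0 1 S = S"
  by (simp add: place_def)

lemma place_translation: "(+) v ` S = place v 1 S"
  by (simp add: place_def)

lemma mem_place_iff:
  assumes "\<alpha> \<noteq> 0"
  shows "z \<in> place x \<alpha> S \<longleftrightarrow> (1 / \<alpha>) *\<^sub>R (z - x) \<in> S"
proof
  assume "z \<in> place x \<alpha> S"
  then show "(1 / \<alpha>) *\<^sub>R (z - x) \<in> S" using assms by (auto simp: place_def)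
next
  assume "(1 / \<alpha>) *\<^sub>R (z - x) \<in> S"
  moreover have "z = x + \<alpha> *\<^sub>R ((1 / \<alpha>) *\<^sub>R (z - x))" using assms by simp
  ultimately show "z \<in> place x \<alpha> S" unfolding place_def by blast
qed

lemma place_mono: "S \<subseteq> S' \<Longrightarrow> place x \<alpha> S \<subseteq> place x \<alpha> S'"
  by (auto simp: place_def)

lemma place_UN: "place x \<alpha> (\<Union>P) = \<Union>(place x \<alpha> ` P)"
  by (auto simp: place_def)

lemma place_Int: "\<alpha> \<noteq> 0 \<Longrightarrow> place x \<alpha> (S \<inter> S') = place x \<alpha> S \<inter> place x \<alpha> S'"
  by (auto simp: mem_place_iff)

lemma place_empty_iff [simp]: "place x \<alpha> S = {} \<longleftrightarrow> S = {}"
  by (simp add: place_def)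

lemma place_inj: "\<alpha> \<noteq> 0 \<Longrightarrow> place x \<alpha> S = place x \<alpha> S' \<longleftrightarrow> S = S'"
proof
  assume "\<alpha> \<noteq> 0" "place x \<alpha> S = place x \<alpha> S'"
  then have "place (- ((1 / \<alpha>) *\<^sub>R x)) (1 / \<alpha>) (place x \<alpha> S) = place (- ((1 / \<alpha>) *\<^sub>R x)) (1 / \<alpha>) (place x \<alpha> S')"
    by simp
  then show "S = S'" using \<open>\<alpha> \<noteq> 0\<close> unfolding place_place by simp
qed simp

lemma place_eq_affine: "place x \<alpha> S = (\<lambda>y. \<alpha> *\<^sub>R y + x) ` S"
  by (simp add: place_def add.commute)

lemma place_eq_translated_scaled: "place x \<alpha> S = (+) x ` ((*\<^sub>R) \<alpha> ` S)"
  by (simp add: place_def image_image)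

lemma inj_scaleR: "\<alpha> \<noteq> 0 \<Longrightarrow> inj ((*\<^sub>R) \<alpha> :: real^'d \<Rightarrow> real^'d)"
  by (rule injI) simp

lemma interior_place: "\<alpha> \<noteq> 0 \<Longrightarrow> interior (place x \<alpha> S) = place x \<alpha> (interior S)"
  unfolding place_eq_translated_scaled interior_translation
  by (subst interior_injective_linear_image) (auto simp: inj_scaleR linear_scale_self)

lemma closure_place: "closure (place x \<alpha> S) = place x \<alpha> (closure S)"
  unfolding place_eq_translated_scaled closure_translation
  by (simp add: closure_scaleR)

lemma frontier_place:
  assumes "\<alpha> \<noteq> 0" shows "frontier (place x \<alpha> S) = place x \<alpha> (frontier S)"
  unfolding frontier_def interior_place[OF assms] closure_place
  using assms by (auto simp: mem_place_iff)

lemma vol_place: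
  fixes S :: "(real^'d) set"
  shows "vol (place x \<alpha> S) = \<bar>\<alpha>\<bar> ^ CARD('d) * vol S"
  unfolding place_eq_affine by (simp add: measure_lebesgue_affine)

lemma emeasure_place:
  fixes S :: "(real^'d) set"
  shows "emeasure lebesgue (place x \<alpha> S) = ennreal (\<bar>\<alpha>\<bar> ^ CARD('d)) * emeasure lebesgue S"
  unfolding place_eq_affine by (simp add: emeasure_lebesgue_affine ennreal_power)

lemma bounded_place: "bounded S \<Longrightarrow> bounded (place x \<alpha> S)"
  unfolding place_eq_translated_scaled by (intro bounded_translation bounded_scaling)

lemma sets_place: "S \<in> sets lebesgue \<Longrightarrow> place x \<alpha> S \<in> sets lebesgue"
  unfolding place_def
  by (rule differentiable_image_in_sets_lebesgue) (auto intro!: derivative_intros)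

lemma place_bound:
  fixes S :: "(real^'d) set"
  assumes "S \<subseteq> cball 0 M" "\<alpha> \<ge> 0"
  shows "place x \<alpha> S \<subseteq> cball x (\<alpha> * M)"
proof
  fix z assume "z \<in> place x \<alpha> S"
  then obtain y where "y \<in> S" "z = x + \<alpha> *\<^sub>R y" by (auto simp: place_def)
  then show "z \<in> cball x (\<alpha> * M)" using assms by (auto simp: dist_norm intro!: mult_left_mono)
qed

lemma tile_place:
  assumes "tile S" "\<alpha> > 0"
  shows "tile (place x \<alpha> S)"
  using assms by (simp add: tile_def bounded_place sets_place vol_place frontier_place emeasure_place)

text \<open>Volumes show that the scales agree. A set that is mapped into itself by a nonzero translation
  contains an unbounded orbit, so the positions agree as well.\<close>
lemma place_cancel:
  fixes S :: "(real^'d) set"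
  assumes eq: "place x \<alpha> S = place y \<beta> S" and pos: "\<alpha> > 0" "\<beta> > 0" and S: "bounded S" "vol S > 0"
  shows "x = y \<and> \<alpha> = \<beta>"
proof -
  have "\<bar>\<alpha>\<bar> ^ CARD('d) = \<bar>\<beta>\<bar> ^ CARD('d)"
    using arg_cong[OF eq, of vol] S unfolding vol_place by simp
  then have ab: "\<alpha> = \<beta>" using pos by (simp add: power_eq_iff_eq_base)
  obtain s where s: "s \<in> S" using S(2) by (cases "S = {}") auto
  define v where "v = (1 / \<alpha>) *\<^sub>R (x - y)"
  have shift: "z + v \<in> S" if "z \<in> S" for z
  proof -
    have "x + \<alpha> *\<^sub>R z \<in> place y \<alpha> S" using that eq ab by (auto simp: place_def)
    then show ?thesis using pos by (simp add: mem_place_iff v_def algebra_simps)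
  qed
  have iter: "s + real n *\<^sub>R v \<in> S" for n
  proof (induction n)
    case (Suc n)
    then show ?case using shift[OF Suc] by (simp add: algebra_simps)
  qed (use s in simp)
  obtain B where B: "\<And>z. z \<in> S \<Longrightarrow> norm z \<le> B" using S(1) by (auto simp: bounded_iff)
  have "v = 0"
  proof (rule ccontr)
    assume "v \<noteq> 0"
    then obtain n :: nat where n: "real n * norm v > B + norm s"
      using reals_Archimedean3[of "norm v"] by auto
    have "real n * norm v = norm ((s + real n *\<^sub>R v) - s)" by simp
    also have "\<dots> \<le> B + norm s" using B[OF iter[of n]] norm_triangle_ineq4[of "s + real n *\<^sub>R v" s] by linarith
    finally show False using n by simp
  qed
  then show ?thesis using ab pos by (simp add: v_def)
qed

lemma tile_interior_nonempty:
  assumes "tile S" shows "interior S \<noteq> {}"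
proof
  assume "interior S = {}"
  then have "S \<subseteq> frontier S" using closure_subset by (auto simp: frontier_def)
  then have "emeasure lebesgue S \<le> emeasure lebesgue (frontier S)"
    by (intro emeasure_mono) auto
  then have "emeasure lebesgue S = 0" using assms by (simp add: tile_def)
  then show False using assms by (simp add: tile_def measure_def)
qed

lemma tile_lmeasurable: "tile S \<Longrightarrow> S \<in> lmeasurable"
  by (simp add: tile_def bounded_set_imp_lmeasurable)

lemma tile_frontier_null: "tile S \<Longrightarrow> frontier S \<in> null_sets lebesgue"
  by (simp add: tile_def null_sets_def)

text \<open>Tiles need not be closed, so two of them may share more than boundary points of both; what they
  share still lies in the boundary of one of them.\<close>
lemma interior_disjoint_null_Int:
  assumes "tile S" "tile S'" "interior S \<inter> interior S' = {}"
  shows "S \<inter> S' \<in> null_sets lebesgue"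
proof (rule null_sets_subset)
  show "frontier S \<union> frontier S' \<in> null_sets lebesgue"
    using assms by (intro null_sets.Un tile_frontier_null)
  show "S \<inter> S' \<in> sets lebesgue" using assms by (auto simp: tile_def)
  show "S \<inter> S' \<subseteq> frontier S \<union> frontier S'"
    using assms(3) closure_subset by (fastforce simp: frontier_def)
qed

lemma tessellation_place:
  assumes P: "tessellation P U" and a: "\<alpha> > 0"
  shows "tessellation (place x \<alpha> ` P) (place x \<alpha> U)"
  unfolding tessellation_def
proof (intro conjI)
  show "\<forall>S\<in>place x \<alpha> ` P. tile S"
    using P a by (auto simp: tessellation_def tile_place)
  show "pairwise (\<lambda>S S'. interior S \<inter> interior S' = {}) (place x \<alpha> ` P)"
  proof (rule pairwiseI)
    fix S S' assume "S \<in> place x \<alpha> ` P" "S' \<in> place x \<alpha> ` P" "S \<noteq> S'"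
    then obtain V V' where V: "V \<in> P" "V' \<in> P" "V \<noteq> V'" "S = place x \<alpha> V" "S' = place x \<alpha> V'"
      by blast
    then have "interior V \<inter> interior V' = {}" using P by (auto simp: tessellation_def dest: pairwiseD)
    then show "interior S \<inter> interior S' = {}"
      using a V by (simp add: interior_place place_Int[symmetric])
  qed
  show "\<Union>(place x \<alpha> ` P) = place x \<alpha> U"
    using P by (auto simp: tessellation_def place_UN[symmetric])
qed

lemma tessellation_disjoint_pieces:
  assumes P: "tessellation P U" and P': "tessellation P' U'" and d: "interior U \<inter> interior U' = {}"
    and S: "S \<in> P" "S' \<in> P'"
  shows "interior S \<inter> interior S' = {}"
proof -
  have "interior S \<subseteq> interior U" "interior S' \<subseteq> interior U'"
    using P P' S by (auto simp: tessellation_def intro!: interior_mono)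
  then show ?thesis using d by blast
qed

lemma tessellation_Union:
  assumes P: "\<And>V. V \<in> R \<Longrightarrow> tessellation (P V) (U V)"
    and d: "\<And>V V'. V \<in> R \<Longrightarrow> V' \<in> R \<Longrightarrow> V \<noteq> V' \<Longrightarrow> interior (U V) \<inter> interior (U V') = {}"
  shows "tessellation (\<Union>V\<in>R. P V) (\<Union>V\<in>R. U V)"
    and "\<And>V V'. V \<in> R \<Longrightarrow> V' \<in> R \<Longrightarrow> V \<noteq> V' \<Longrightarrow> P V \<inter> P V' = {}"
proof -
  have dd: "interior S \<inter> interior S' = {}"
    if "V \<in> R" "V' \<in> R" "V \<noteq> V'" "S \<in> P V" "S' \<in> P V'" for V V' S S'
    using tessellation_disjoint_pieces[OF P[OF that(1)] P[OF that(2)] d[OF that(1-3)] that(4,5)] .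
  show "P V \<inter> P V' = {}" if V: "V \<in> R" "V' \<in> R" "V \<noteq> V'" for V V'
  proof (rule ccontr)
    assume "P V \<inter> P V' \<noteq> {}"
    then obtain S where S: "S \<in> P V" "S \<in> P V'" by blast
    then have "interior S = {}" using dd[OF V S] by simp
    moreover have "tile S" using P[OF V(1)] S by (auto simp: tessellation_def)
    ultimately show False using tile_interior_nonempty by blast
  qed
  show "tessellation (\<Union>V\<in>R. P V) (\<Union>V\<in>R. U V)"
    unfolding tessellation_def
  proof (intro conjI)
    show "\<forall>S\<in>\<Union>V\<in>R. P V. tile S" using P by (auto simp: tessellation_def)
    have "(\<Union>V\<in>R. U V) = (\<Union>V\<in>R. \<Union>(P V))" using P by (simp add: tessellation_def)
    then show "\<Union>(\<Union>V\<in>R. P V) = (\<Union>V\<in>R. U V)" by blast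
    show "pairwise (\<lambda>S S'. interior S \<inter> interior S' = {}) (\<Union>V\<in>R. P V)"
    proof (rule pairwiseI)
      fix S S' assume S: "S \<in> (\<Union>V\<in>R. P V)" "S' \<in> (\<Union>V\<in>R. P V)" "S \<noteq> S'"
      then obtain V V' where V: "V \<in> R" "V' \<in> R" "S \<in> P V" "S' \<in> P V'" by blast
      show "interior S \<inter> interior S' = {}"
      proof (cases "V = V'")
        case True
        then show ?thesis using P[OF V(1)] V S(3) by (auto simp: tessellation_def pairwise_def)
      next
        case False
        then show ?thesis using dd V by blast
      qed
    qed
  qed
qed

lemma tile_almost_disjoint_from_rest:
  assumes P: "tessellation P U" and Q: "Q \<subseteq> P" "finite Q" and S: "S \<in> P" "S \<notin> Q"
  shows "S \<inter> \<Union>Q \<in> null_sets lebesgue"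
proof -
  have "S \<inter> \<Union>Q = (\<Union>S'\<in>Q. S \<inter> S')" by auto
  also have "\<dots> \<in> null_sets lebesgue"
  proof (rule null_sets.finite_UN)
    fix S' assume "S' \<in> Q"
    with Q S have S': "S' \<in> P" "S \<noteq> S'" by auto
    have "interior S \<inter> interior S' = {}"
      using P S(1) S' unfolding tessellation_def by (blast dest: pairwiseD)
    then show "S \<inter> S' \<in> null_sets lebesgue"
      using P S S' by (intro interior_disjoint_null_Int) (auto simp: tessellation_def)
  qed (use Q in auto)
  finally show ?thesis .
qed

section \<open>Limits of homothetic copies\<close>

text \<open>Among the points of \<open>place x \<alpha> K\<close> the image of \<open>p\<close> is extremal in direction \<open>b\<close>, and likewise for
  \<open>place y \<beta> K\<close>. Sets that are Hausdorff-close have close extremal values.\<close>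
lemma support_functions_close:
  fixes K :: "(real^'d) set" and b :: "real^'d"
  assumes K: "compact K" "p \<in> K" and b: "norm b \<le> 1"
    and max: "\<And>q. q \<in> K \<Longrightarrow> b \<bullet> q \<le> b \<bullet> p"
    and pos: "\<alpha> \<ge> 0" "\<beta> \<ge> 0"
    and near: "\<And>u. u \<in> place x \<alpha> K \<Longrightarrow> \<exists>v\<in>place y \<beta> K. dist u v \<le> r"
    and near': "\<And>v. v \<in> place y \<beta> K \<Longrightarrow> \<exists>u\<in>place x \<alpha> K. dist v u \<le> r"
  shows "\<bar>(b \<bullet> x + \<alpha> * (b \<bullet> p)) - (b \<bullet> y + \<beta> * (b \<bullet> p))\<bar> \<le> r"
proof -
  have *: "b \<bullet> x + \<alpha> * (b \<bullet> p) \<le> b \<bullet> y + \<beta> * (b \<bullet> p) + r"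
    if near: "\<And>u. u \<in> place x \<alpha> K \<Longrightarrow> \<exists>v\<in>place y \<beta> K. dist u v \<le> r" and "\<beta> \<ge> 0" for x y \<alpha> \<beta>
  proof -
    obtain q where q: "q \<in> K" "dist (x + \<alpha> *\<^sub>R p) (y + \<beta> *\<^sub>R q) \<le> r"
      using near[of "x + \<alpha> *\<^sub>R p"] K(2) by (auto simp: place_def)
    have "b \<bullet> ((x + \<alpha> *\<^sub>R p) - (y + \<beta> *\<^sub>R q)) \<le> norm b * norm ((x + \<alpha> *\<^sub>R p) - (y + \<beta> *\<^sub>R q))"
      using norm_cauchy_schwarz by blast
    also have "\<dots> \<le> 1 * norm ((x + \<alpha> *\<^sub>R p) - (y + \<beta> *\<^sub>R q))" by (intro mult_right_mono b) simp
    also have "\<dots> \<le> r" using q(2) by (simp add: dist_norm)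
    finally have "b \<bullet> x + \<alpha> * (b \<bullet> p) \<le> b \<bullet> y + \<beta> * (b \<bullet> q) + r"
      by (simp add: inner_diff_right inner_add_right)
    moreover have "\<beta> * (b \<bullet> q) \<le> \<beta> * (b \<bullet> p)" using max[OF q(1)] \<open>\<beta> \<ge> 0\<close> by (rule mult_left_mono)
    ultimately show ?thesis by linarith
  qed
  have "b \<bullet> x + \<alpha> * (b \<bullet> p) \<le> b \<bullet> y + \<beta> * (b \<bullet> p) + r"
    by (rule *) (use near pos in auto)
  moreover have "b \<bullet> y + \<beta> * (b \<bullet> p) \<le> b \<bullet> x + \<alpha> * (b \<bullet> p) + r"
    by (rule *) (use near' pos in auto)
  ultimately show ?thesis by linarith
qed

text \<open>Hausdorff convergence of copies of \<open>K\<close> forces their positions and scales to converge. In a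
  coordinate direction, the maximum and the minimum of the copies converge; their difference is the
  scale times the width of \<open>K\<close>, which determines the scale, and then the position.\<close>
lemma homothetic_copies_converge:
  fixes K :: "(real^'d) set"
  assumes K: "compact K"
    and wide: "\<And>i. \<exists>p\<in>K. p $ i > 0" "\<And>i. \<exists>p\<in>K. p $ i < 0"
    and pos: "\<And>k. \<alpha> k \<ge> 0" "\<beta> \<ge> 0"
    and near: "\<And>e. e > 0 \<Longrightarrow> \<forall>\<^sub>F k in sequentially.
        (\<forall>u\<in>place (x k) (\<alpha> k) K. \<exists>v\<in>place y \<beta> K. dist u v \<le> e) \<and>
        (\<forall>v\<in>place y \<beta> K. \<exists>u\<in>place (x k) (\<alpha> k) K. dist v u \<le> e)"
  shows "x \<longlonglongrightarrow> y \<and> \<alpha> \<longlonglongrightarrow> \<beta>"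
proof -
  have lim: "(\<lambda>k. b \<bullet> x k + \<alpha> k * (b \<bullet> p)) \<longlonglongrightarrow> b \<bullet> y + \<beta> * (b \<bullet> p)"
    if b: "norm b \<le> 1" and p: "p \<in> K" and max: "\<And>q. q \<in> K \<Longrightarrow> b \<bullet> q \<le> b \<bullet> p" for b p
  proof (rule tendstoI)
    fix e :: real assume "e > 0"
    then have "\<forall>\<^sub>F k in sequentially.
        (\<forall>u\<in>place (x k) (\<alpha> k) K. \<exists>v\<in>place y \<beta> K. dist u v \<le> e / 2) \<and>
        (\<forall>v\<in>place y \<beta> K. \<exists>u\<in>place (x k) (\<alpha> k) K. dist v u \<le> e / 2)"
      using near[of "e / 2"] by simp
    then show "\<forall>\<^sub>F k in sequentially. dist (b \<bullet> x k + \<alpha> k * (b \<bullet> p)) (b \<bullet> y + \<beta> * (b \<bullet> p)) < e"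
    proof eventually_elim
      case (elim k)
      have "\<bar>(b \<bullet> x k + \<alpha> k * (b \<bullet> p)) - (b \<bullet> y + \<beta> * (b \<bullet> p))\<bar> \<le> e / 2"
        by (rule support_functions_close[OF K p b max pos]) (use elim in auto)
      then show ?case using \<open>e > 0\<close> by (simp add: dist_real_def)
    qed
  qed
  have maxpt: "\<exists>p\<in>K. \<forall>q\<in>K. b \<bullet> q \<le> b \<bullet> p" for b :: "real^'d"
  proof (rule continuous_attains_sup[OF K])
    show "K \<noteq> {}" using wide(1) by blast
  qed (intro continuous_intros)
  have coord: "\<exists>h. (\<lambda>k. x k $ i + \<alpha> k * h) \<longlonglongrightarrow> y $ i + \<beta> * h" and al: "\<alpha> \<longlonglongrightarrow> \<beta>" for i
  proof -
    define b :: "real^'d" where "b = axis i 1"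
    have nb: "norm b \<le> 1" "norm (- b) \<le> 1" by (simp_all add: b_def)
    have bi: "b \<bullet> q = q $ i" for q by (simp add: b_def inner_axis inner_commute)
    obtain p where p: "p \<in> K" "\<And>q. q \<in> K \<Longrightarrow> b \<bullet> q \<le> b \<bullet> p" using maxpt by blast
    obtain p' where p': "p' \<in> K" "\<And>q. q \<in> K \<Longrightarrow> (- b) \<bullet> q \<le> (- b) \<bullet> p'" using maxpt by blast
    have l1: "(\<lambda>k. x k $ i + \<alpha> k * (p $ i)) \<longlonglongrightarrow> y $ i + \<beta> * (p $ i)"
      using lim[OF nb(1) p] by (simp add: bi)
    have l2: "(\<lambda>k. - (x k $ i) - \<alpha> k * (p' $ i)) \<longlonglongrightarrow> - (y $ i) - \<beta> * (p' $ i)"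
      using lim[OF nb(2) p'] by (simp add: bi)
    have w: "p $ i - p' $ i > 0"
    proof -
      obtain q q' where "q \<in> K" "q $ i > 0" "q' \<in> K" "q' $ i < 0" using wide by metis
      then show ?thesis using p(2)[of q] p'(2)[of q'] by (simp add: bi)
    qed
    have "(\<lambda>k. ((x k $ i + \<alpha> k * (p $ i)) + (- (x k $ i) - \<alpha> k * (p' $ i))) / (p $ i - p' $ i)) \<longlonglongrightarrow>
        ((y $ i + \<beta> * (p $ i)) + (- (y $ i) - \<beta> * (p' $ i))) / (p $ i - p' $ i)"
      using w by (intro tendsto_intros l1 l2) simp
    moreover have "((z + a * (p $ i)) + (- z - a * (p' $ i))) / (p $ i - p' $ i) = a" for z a
    proof -
      have "(z + a * (p $ i)) + (- z - a * (p' $ i)) = a * (p $ i - p' $ i)" by (simp add: right_diff_distrib)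
      then show ?thesis using w by simp
    qed
    ultimately show "\<alpha> \<longlonglongrightarrow> \<beta>" by simp
    show "\<exists>h. (\<lambda>k. x k $ i + \<alpha> k * h) \<longlonglongrightarrow> y $ i + \<beta> * h" using l1 by blast
  qed
  have "x \<longlonglongrightarrow> y"
  proof (rule vec_tendstoI)
    fix i
    obtain h where "(\<lambda>k. x k $ i + \<alpha> k * h) \<longlonglongrightarrow> y $ i + \<beta> * h" using coord by blast
    then have "(\<lambda>k. (x k $ i + \<alpha> k * h) - \<alpha> k * h) \<longlonglongrightarrow> (y $ i + \<beta> * h) - \<beta> * h"
      by (intro tendsto_diff tendsto_mult tendsto_const al)
    then show "(\<lambda>k. x k $ i) \<longlonglongrightarrow> y $ i" by simp
  qed
  with al show ?thesis by blast
qed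

lemma frontier_wide:
  fixes S :: "(real^'d) set"
  assumes "bounded S" "0 \<in> interior S"
  shows "\<exists>p\<in>frontier S. p $ i > 0" "\<exists>p\<in>frontier S. p $ i < 0"
proof -
  have a: "axis i (1::real) \<noteq> (0 :: real^'d)" by (simp add: axis_eq_0_iff)
  obtain d where "0 < d" "0 + d *\<^sub>R axis i 1 \<in> frontier S"
    using ray_to_frontier[OF assms a] by metis
  then show "\<exists>p\<in>frontier S. p $ i > 0" by (intro bexI) auto
  have a: "- axis i (1::real) \<noteq> (0 :: real^'d)" by (simp add: axis_eq_0_iff)
  obtain d where "0 < d" "0 + d *\<^sub>R (- axis i 1) \<in> frontier S"
    using ray_to_frontier[OF assms a] by metis
  then show "\<exists>p\<in>frontier S. p $ i < 0" by (intro bexI) auto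
qed

text \<open>The metric \<^const>\<open>D\<close> compares sets only inside a large ball. Since the sets \<open>A k\<close> have bounded
  diameter and come close to \<open>B\<close>, they lie entirely in that ball, and the comparison becomes
  one in Hausdorff distance.\<close>
lemma D_limit_compact:
  fixes A :: "nat \<Rightarrow> (real^'d) set"
  assumes lim: "(\<lambda>k. D (A k) B) \<longlonglongrightarrow> 0" and B: "compact B" "B \<noteq> {}"
    and A: "\<And>k. compact (A k)" "\<And>k. A k \<noteq> {}" "\<And>k p q. p \<in> A k \<Longrightarrow> q \<in> A k \<Longrightarrow> dist p q \<le> M"
    and e: "e > 0"
  shows "\<forall>\<^sub>F k in sequentially. (\<forall>u\<in>A k. \<exists>v\<in>B. dist u v \<le> e) \<and> (\<forall>v\<in>B. \<exists>u\<in>A k. dist v u \<le> e)"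
proof -
  obtain \<rho> where \<rho>: "\<rho> > 0" "\<And>q. q \<in> B \<Longrightarrow> norm q \<le> \<rho>"
    using compact_imp_bounded[OF B(1)] bounded_pos[of B] by blast
  have M: "M \<ge> 0"
  proof -
    obtain p where "p \<in> A 0" using A(2)[of 0] by blast
    then show ?thesis using A(3)[of p 0 p] by simp
  qed
  \<comment> \<open>for \<open>r < r0\<close> the ball of radius \<open>1/r\<close> contains \<open>B\<close> and every set of diameter \<open>M\<close> within distance 1 of \<open>B\<close>\<close>
  define r0 where "r0 = min e (1 / (\<rho> + 2 + M))"
  have r0: "r0 > 0" "r0 \<le> e" "r0 \<le> 1 / (\<rho> + 2 + M)" using e \<rho> M by (auto simp: r0_def)
  have "1 / (\<rho> + 2 + M) < 1" using \<rho> M by simp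
  then have r01: "r0 < 1" using r0 by linarith
  have nb: "\<exists>v\<in>C. dist u v \<le> r" if u: "u \<in> neighborhood r C" and C: "compact C" for u r and C :: "(real^'d) set"
  proof -
    have "C \<noteq> {}" "infdist u C \<le> r" using u by (auto simp: neighborhood_def)
    then obtain v where "v \<in> C" "infdist u C = dist u v"
      using infdist_attains_inf[OF compact_imp_closed[OF C]] by metis
    then show ?thesis using \<open>infdist u C \<le> r\<close> by auto
  qed
  have "\<forall>\<^sub>F k in sequentially. D (A k) B < r0" using lim r0(1) by (rule order_tendstoD)
  then show ?thesis
  proof eventually_elim
    case (elim k)
    define R where "R = {r. r > 0 \<and> A k \<inter> ball 0 (1/r) \<subseteq> neighborhood r B \<and> B \<inter> ball 0 (1/r) \<subseteq> neighborhood r (A k)} \<union> {1}"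
    have "Inf R < r0" using elim by (simp add: D_def R_def)
    moreover have "R \<noteq> {}" by (simp add: R_def)
    ultimately obtain r where r: "r \<in> R" "r < r0" using cInf_lessD by blast
    then have r': "r > 0" "A k \<inter> ball 0 (1/r) \<subseteq> neighborhood r B" "B \<inter> ball 0 (1/r) \<subseteq> neighborhood r (A k)"
      using r01 by (auto simp: R_def)
    have "r * (\<rho> + 2 + M) < 1"
    proof -
      have "r * (\<rho> + 2 + M) < r0 * (\<rho> + 2 + M)" using r \<rho> M by (intro mult_strict_right_mono) auto
      also have "\<dots> \<le> 1" using r0(3) \<rho> M by (simp add: pos_le_divide_eq)
      finally show ?thesis .
    qed
    then have big: "\<rho> + 2 + M < 1 / r" using r'(1) by (simp add: pos_less_divide_eq mult.commute)
    have v: "\<exists>u\<in>A k. dist v u \<le> r" if "v \<in> B" for v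
    proof (rule nb[OF _ A(1)])
      have "norm v < 1 / r" using \<rho>(2)[OF that] big M by linarith
      then show "v \<in> neighborhood r (A k)" using r'(3) that by auto
    qed
    obtain q0 where q0: "q0 \<in> B" using B(2) by blast
    then obtain p0 where p0: "p0 \<in> A k" "dist q0 p0 \<le> r" using v by blast
    have u: "\<exists>v\<in>B. dist u v \<le> r" if u: "u \<in> A k" for u
    proof (rule nb[OF _ B(1)])
      have "norm u \<le> norm q0 + dist q0 p0 + dist p0 u"
        using dist_triangle[of 0 u q0] dist_triangle[of q0 u p0] by (simp add: dist_norm)
      also have "\<dots> < 1 / r" using \<rho>(2)[OF q0] p0(2) A(3)[OF p0(1) u] r r01 big by linarith
      finally show "u \<in> neighborhood r B" using r'(2) u by auto
    qed
    have "r \<le> e" using r(2) r0(2) by linarith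
    then show ?case using u v by (meson order_trans)
  qed
qed

text \<open>Outside the null set of boundary points, every point of \<open>B\<close> is interior to a tile and therefore
  eventually covered by the corresponding copy; dominated convergence concludes.\<close>
lemma copies_cover_in_measure:
  fixes B :: "(real^'d) set"
  assumes P: "finite P" and B: "B \<in> lmeasurable"
    and cover: "\<And>p. p \<in> B \<Longrightarrow> \<exists>S\<in>P. p \<in> S"
    and copies: "\<And>S. S \<in> P \<Longrightarrow> tile S" "\<And>S k. S \<in> P \<Longrightarrow> g k S \<in> sets lebesgue"
    and conv: "\<And>S p. S \<in> P \<Longrightarrow> p \<in> interior S \<Longrightarrow> \<forall>\<^sub>F k in sequentially. p \<in> g k S"
  shows "(\<lambda>k. vol (B - \<Union>(g k ` P))) \<longlonglongrightarrow> 0"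
proof -
  have meas: "B - \<Union>(g k ` P) \<in> sets lebesgue" for k
    using B P copies(2) by (intro sets.Diff sets.finite_Union) auto
  have null: "(\<Union>S\<in>P. frontier S) \<in> null_sets lebesgue"
    using P copies(1) by (intro null_sets.finite_UN tile_frontier_null) auto
  have "(\<lambda>k. \<integral>p. indicator (B - \<Union>(g k ` P)) p \<partial>lebesgue) \<longlonglongrightarrow> (\<integral>p. (0::real) \<partial>(lebesgue :: (real^'d) measure))"
  proof (rule integral_dominated_convergence)
    show "integrable lebesgue (indicator B :: _ \<Rightarrow> real)"
      using B by (intro integrable_real_indicator) (auto simp: fmeasurable_def)
    show "AE p in lebesgue. (\<lambda>k. indicator (B - \<Union>(g k ` P)) p) \<longlonglongrightarrow> (0::real)"
    proof (rule AE_I'[OF null], rule subsetI, rule ccontr)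
      fix p assume p: "p \<in> {p \<in> space lebesgue. \<not> (\<lambda>k. indicator (B - \<Union>(g k ` P)) p) \<longlonglongrightarrow> (0::real)}"
        "p \<notin> (\<Union>S\<in>P. frontier S)"
      have "\<forall>\<^sub>F k in sequentially. indicator (B - \<Union>(g k ` P)) p = (0::real)"
      proof (cases "p \<in> B")
        case True
        then obtain S where S: "S \<in> P" "p \<in> S" using cover by blast
        then have "p \<in> interior S" using p(2) closure_subset by (auto simp: frontier_def)
        from conv[OF S(1) this] show ?thesis
        proof eventually_elim
          case (elim k)
          then have "p \<notin> B - \<Union>(g k ` P)" using S(1) by blast
          then show ?case by (rule indicator_simps(2))
        qed
      qed simp
      then show False using p(1) tendsto_eventually by fastforce
    qed
    fix k
    show "indicator (B - \<Union>(g k ` P)) \<in> borel_measurable (lebesgue :: (real^'d) measure)"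
      by (rule borel_measurable_indicator[OF meas])
    show "AE p in lebesgue. norm (indicator (B - \<Union>(g k ` P)) p :: real) \<le> indicator B p"
      by (intro always_eventually allI) (simp split: split_indicator)
  qed simp
  then show ?thesis using meas by simp
qed

section \<open>Lattice points and neighbourhoods of the boundary\<close>

lemma scaled_lattice_diff:
  assumes "z \<in> scaled_lattice \<alpha>" "z' \<in> scaled_lattice \<alpha>"
  shows "\<exists>n::int. z $ i - z' $ i = \<alpha> * of_int n"
proof -
  obtain w w' where w: "z = \<alpha> *\<^sub>R w" "z' = \<alpha> *\<^sub>R w'" "w $ i \<in> \<int>" "w' $ i \<in> \<int>"
    using assms by (auto simp: scaled_lattice_def)
  then have "w $ i - w' $ i \<in> \<int>" by simp
  then obtain n where "w $ i - w' $ i = of_int n" by (auto elim: Ints_cases)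
  then have "z $ i - z' $ i = \<alpha> * of_int n" using w by (simp add: right_diff_distrib[symmetric])
  then show ?thesis by blast
qed

text \<open>Half-open, so that the cells of the points of \<open>\<alpha>\<int>\<^sup>d\<close> partition the space.\<close>
definition cell :: "real \<Rightarrow> real^'d \<Rightarrow> (real^'d) set" where
  "cell \<alpha> z = {p. \<forall>i. z $ i \<le> p $ i \<and> p $ i < z $ i + \<alpha>}"

lemma cell_exists:
  fixes p :: "real^'d"
  assumes "\<alpha> > 0"
  shows "\<exists>z\<in>scaled_lattice \<alpha>. p \<in> cell \<alpha> z"
proof
  define w :: "real^'d" where "w = (\<chi> i. of_int \<lfloor>p $ i / \<alpha>\<rfloor>)"
  show "\<alpha> *\<^sub>R w \<in> scaled_lattice \<alpha>" unfolding scaled_lattice_def by (auto simp: w_def)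
  have "of_int \<lfloor>p $ i / \<alpha>\<rfloor> * \<alpha> \<le> p $ i" "p $ i < (of_int \<lfloor>p $ i / \<alpha>\<rfloor> + 1) * \<alpha>" for i
    using floor_correct[of "p $ i / \<alpha>"] assms
    by (metis pos_le_divide_eq) (metis assms floor_correct of_int_1 of_int_add pos_divide_less_eq)
  then show "p \<in> cell \<alpha> (\<alpha> *\<^sub>R w)" by (simp add: cell_def w_def algebra_simps)
qed

lemma cell_disjoint:
  assumes a: "\<alpha> > 0" and z: "z \<in> scaled_lattice \<alpha>" "z' \<in> scaled_lattice \<alpha>" and p: "p \<in> cell \<alpha> z" "p \<in> cell \<alpha> z'"
  shows "z = z'"
proof (subst vec_eq_iff, intro allI)
  fix i
  obtain n :: int where n: "z $ i - z' $ i = \<alpha> * of_int n" using scaled_lattice_diff[OF z] by blast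
  have "\<bar>z $ i - z' $ i\<bar> < \<alpha>" using p unfolding cell_def by (simp add: abs_less_iff) (smt (verit))
  then have "\<alpha> * \<bar>of_int n\<bar> < \<alpha> * 1" using n a by (simp add: abs_mult)
  then have "\<bar>of_int n\<bar> < (1 :: real)" using a by (simp only: mult_less_cancel_left_pos)
  then have "n = 0" by linarith
  then show "z $ i = z' $ i" using n by simp
qed

lemma cell_dist:
  fixes p z :: "real^'d"
  assumes "p \<in> cell \<alpha> z"
  shows "dist p z \<le> \<alpha> * CARD('d)"
proof -
  have "norm (p - z) \<le> (\<Sum>i\<in>UNIV. \<bar>(p - z) $ i\<bar>)" by (rule norm_le_l1_cart)
  also have "\<dots> \<le> (\<Sum>i\<in>(UNIV::'d set). \<alpha>)"
  proof (rule sum_mono)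
    fix i show "\<bar>(p - z) $ i\<bar> \<le> \<alpha>" using assms unfolding cell_def by (simp add: abs_le_iff) (smt (verit))
  qed
  finally show ?thesis by (simp add: dist_norm mult.commute)
qed

lemma vol_cell:
  fixes z :: "real^'d"
  assumes "\<alpha> > 0"
  shows "cell \<alpha> z \<in> lmeasurable \<and> vol (cell \<alpha> z) = \<alpha> ^ CARD('d)"
proof -
  define b where "b = z + (\<chi> i. \<alpha>)"
  have sub: "box z b \<subseteq> cell \<alpha> z" "cell \<alpha> z \<subseteq> cbox z b"
    by (auto simp: b_def cell_def mem_box_cart less_imp_le)
  have vb: "measure lebesgue (cbox z b) = \<alpha> ^ CARD('d)"
  proof -
    have "measure lborel (cbox z b) = (\<Prod>i\<in>UNIV. b $ i - z $ i)"
      using assms by (intro content_cbox_cart) (auto simp: b_def interval_ne_empty_cart less_imp_le)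
    then show ?thesis by (simp add: b_def)
  qed
  have bd: "cbox z b - box z b \<in> null_sets lebesgue"
    using negligible_frontier_interval[of z b] by (simp add: negligible_iff_null_sets)
  have "cell \<alpha> z = box z b \<union> (cell \<alpha> z - box z b)" using sub by blast
  moreover have n: "cell \<alpha> z - box z b \<in> null_sets lebesgue"
    using bd sub by (intro null_sets_completion_subset[OF _ bd]) auto
  ultimately have m: "cell \<alpha> z \<in> sets lebesgue" by (metis sets.Un lmeasurable_box fmeasurableD null_setsD2)
  have "cell \<alpha> z \<in> lmeasurable" using m sub by (intro fmeasurableI2[OF lmeasurable_cbox]) auto
  moreover have "measure lebesgue (cbox z b) = measure lebesgue (cell \<alpha> z)"
  proof -
    have "cbox z b = cell \<alpha> z \<union> (cbox z b - cell \<alpha> z)" using sub by blast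
    moreover have "cbox z b - cell \<alpha> z \<in> null_sets lebesgue"
      using bd sub by (intro null_sets_completion_subset[OF _ bd]) auto
    ultimately show ?thesis using measure_Un_null_set[OF m] by metis
  qed
  ultimately show ?thesis using vb by simp
qed

lemma vol_cells:
  fixes Z :: "(real^'d) set"
  assumes "\<alpha> > 0" "finite Z" "Z \<subseteq> scaled_lattice \<alpha>"
  shows "(\<Union>z\<in>Z. cell \<alpha> z) \<in> lmeasurable \<and> vol (\<Union>z\<in>Z. cell \<alpha> z) = real (card Z) * \<alpha> ^ CARD('d)"
proof
  show "(\<Union>z\<in>Z. cell \<alpha> z) \<in> lmeasurable" using assms vol_cell by (intro fmeasurable.finite_UN) auto
  have "vol (\<Union>z\<in>Z. cell \<alpha> z) = (\<Sum>z\<in>Z. vol (cell \<alpha> z))"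
    using assms vol_cell cell_disjoint by (intro measure_UNION') (auto simp: pairwise_def disjnt_def, blast)
  moreover have "vol (cell \<alpha> z) = \<alpha> ^ CARD('d)" for z :: "real^'d" using vol_cell[OF assms(1)] by blast
  ultimately show "vol (\<Union>z\<in>Z. cell \<alpha> z) = real (card Z) * \<alpha> ^ CARD('d)" by simp
qed

lemma lmeasurable_neighborhood:
  fixes A :: "(real^'d) set"
  assumes "compact A" "r > 0"
  shows "neighborhood r A \<in> lmeasurable"
proof (cases "A = {}")
  case False
  then have "neighborhood r A = {x. infdist x A \<le> r}" by (auto simp: neighborhood_def)
  then show ?thesis using compact_infdist_le[OF False assms] by (simp add: lmeasurable_compact)
qed (simp add: neighborhood_def)

lemma near_frontier:
  fixes p q :: "real^'d"
  assumes "p \<in> S" "q \<notin> S" "dist p q \<le> r"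
  shows "p \<in> neighborhood r (frontier S)" "q \<in> neighborhood r (frontier S)"
proof -
  have "closed_segment p q \<inter> frontier S \<noteq> {}"
    using assms by (intro connected_Int_frontier) auto
  then obtain x where x: "x \<in> closed_segment p q" "x \<in> frontier S" by blast
  then have "dist x p \<le> r" "dist x q \<le> r"
    using assms(3) dist_in_closed_segment[OF x(1)] by (auto simp: dist_commute)
  then show "p \<in> neighborhood r (frontier S)" "q \<in> neighborhood r (frontier S)"
    using x(2) by (auto simp: neighborhood_def dist_commute intro: infdist_le2)
qed

text \<open>The cells of the points of \<open>Z\<close> cover \<open>\<Omega>\<close> and are covered by \<open>\<Omega>\<close>, in both cases up to a
  neighbourhood of the boundary of \<open>\<Omega>\<close>: a point that violates one of the inclusions is joined by a short
  segment to a point on the other side of the boundary.\<close>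
lemma lattice_point_count:
  fixes \<Omega> Z :: "(real^'d) set"
  assumes a: "\<alpha> > 0" and \<Omega>: "bounded \<Omega>" "\<Omega> \<in> sets lebesgue" and C: "C > 0"
    and Z: "finite Z" "Z \<subseteq> scaled_lattice \<alpha>"
    and near: "\<And>z. z \<in> Z \<Longrightarrow> \<exists>p\<in>\<Omega>. dist z p \<le> C"
    and deep: "\<And>z. z \<in> scaled_lattice \<alpha> \<Longrightarrow> ball z C \<subseteq> \<Omega> \<Longrightarrow> z \<in> Z"
  shows "\<bar>real (card Z) * \<alpha> ^ CARD('d) - vol \<Omega>\<bar> \<le> vol (neighborhood (C + \<alpha> * CARD('d)) (frontier \<Omega>))"
proof -
  define r where "r = C + \<alpha> * CARD('d)"
  define N where "N = neighborhood r (frontier \<Omega>)"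
  have r: "r > 0" using a C by (simp add: r_def add_pos_nonneg)
  have N: "N \<in> lmeasurable" unfolding N_def
    using \<Omega>(1) r by (intro lmeasurable_neighborhood compact_frontier_bounded)
  have \<Omega>m: "\<Omega> \<in> lmeasurable" using \<Omega> by (simp add: bounded_set_imp_lmeasurable)
  let ?U = "\<Union>z\<in>Z. cell \<alpha> z"
  have U: "?U \<in> lmeasurable" "vol ?U = real (card Z) * \<alpha> ^ CARD('d)" using vol_cells[OF a Z] by auto
  have "?U \<subseteq> \<Omega> \<union> N"
  proof
    fix p assume "p \<in> ?U"
    then obtain z where z: "z \<in> Z" "p \<in> cell \<alpha> z" by blast
    obtain q where q: "q \<in> \<Omega>" "dist z q \<le> C" using near z by blast
    have "dist q p \<le> r" using q(2) cell_dist[OF z(2)] dist_triangle[of q p z]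
      unfolding r_def by (simp add: dist_commute)
    then show "p \<in> \<Omega> \<union> N" using near_frontier(2)[OF q(1)] unfolding N_def by blast
  qed
  then have "vol ?U \<le> vol (\<Omega> \<union> N)" using U(1) \<Omega>m N by (intro measure_mono_fmeasurable) auto
  also have "\<dots> \<le> vol \<Omega> + vol N" using \<Omega>m N by (intro measure_Un_le) auto
  finally have up: "vol ?U \<le> vol \<Omega> + vol N" .
  have "\<Omega> \<subseteq> ?U \<union> N"
  proof
    fix p assume p: "p \<in> \<Omega>"
    obtain z where z: "z \<in> scaled_lattice \<alpha>" "p \<in> cell \<alpha> z" using cell_exists[OF a] by blast
    show "p \<in> ?U \<union> N"
    proof (cases "ball z C \<subseteq> \<Omega>")
      case True
      then show ?thesis using deep z by blast
    next
      case False
      then obtain q where q: "dist z q < C" "q \<notin> \<Omega>" unfolding subset_iff mem_ball by blast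
      have "dist p q \<le> r" using q(1) cell_dist[OF z(2)] dist_triangle[of p q z] unfolding r_def by simp
      then show ?thesis using near_frontier(1)[OF p q(2)] unfolding N_def by blast
    qed
  qed
  then have "vol \<Omega> \<le> vol (?U \<union> N)" using U(1) \<Omega>m N by (intro measure_mono_fmeasurable) auto
  also have "\<dots> \<le> vol ?U + vol N" using U(1) N by (intro measure_Un_le) auto
  finally have "vol \<Omega> \<le> vol ?U + vol N" .
  with up show ?thesis unfolding U(2) N_def r_def by linarith
qed

lemma neighborhood_place:
  fixes A :: "(real^'d) set"
  assumes "compact A" "C > 0" "r > 0"
  shows "vol (neighborhood (C * r) (place x C A)) \<le> C ^ CARD('d) * vol (neighborhood r A)"
proof -
  have cp: "compact (place x C A)" unfolding place_def
    using assms by (intro compact_continuous_image continuous_intros)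
  have "neighborhood (C * r) (place x C A) \<subseteq> place x C (neighborhood r A)"
  proof
    fix z assume z: "z \<in> neighborhood (C * r) (place x C A)"
    then have "place x C A \<noteq> {}" "infdist z (place x C A) \<le> C * r" by (auto simp: neighborhood_def)
    then obtain v where v: "v \<in> place x C A" "dist z v \<le> C * r"
      using infdist_attains_inf[OF compact_imp_closed[OF cp]] by metis
    then obtain a where a: "a \<in> A" "v = x + C *\<^sub>R a" by (auto simp: place_def)
    define w where "w = (1 / C) *\<^sub>R (z - x)"
    have zw: "z = x + C *\<^sub>R w" using assms by (simp add: w_def)
    have "dist z v = C * dist w a" using assms unfolding zw a(2) dist_norm
      by (simp add: scaleR_diff_right[symmetric])
    then have "C * dist w a \<le> C * r" using v by simp
    then have "dist w a \<le> r" using assms by (simp only: mult_le_cancel_left_pos)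
    then have "w \<in> neighborhood r A" using a(1) by (auto simp: neighborhood_def intro: infdist_le2)
    then show "z \<in> place x C (neighborhood r A)" using zw by (auto simp: place_def)
  qed
  moreover have "place x C (neighborhood r A) \<in> lmeasurable"
    using lmeasurable_neighborhood[OF assms(1,3)] emeasure_place[of x C "neighborhood r A"]
    by (intro fmeasurableI sets_place) (auto simp: fmeasurable_def ennreal_mult_less_top)
  moreover have "neighborhood (C * r) (place x C A) \<in> lmeasurable"
    using cp assms by (intro lmeasurable_neighborhood) auto
  ultimately have "vol (neighborhood (C * r) (place x C A)) \<le> vol (place x C (neighborhood r A))"
    by (intro measure_mono_fmeasurable) auto
  then show ?thesis using assms by (simp add: vol_place)
qed

section \<open>Tiles and substitution paths of a scheme\<close>

locale normalized_scheme =
  fixes \<sigma> :: "('d::finite) scheme"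
  assumes scheme: "multiscale_scheme \<sigma>" and norm1: "normalized \<sigma>"
begin

abbreviation T :: "nat \<Rightarrow> (real^'d) set" where "T i \<equiv> prototiles \<sigma> ! i"
abbreviation n\<^sub>\<sigma> :: nat where "n\<^sub>\<sigma> \<equiv> num_types \<sigma>"

lemma tile_T: "i < n\<^sub>\<sigma> \<Longrightarrow> tile (T i)"
  using scheme by (simp add: multiscale_scheme_def)

lemma vol_T: "i < n\<^sub>\<sigma> \<Longrightarrow> vol (T i) = 1"
  using norm1 by (simp add: normalized_def)

lemma zero_interior_T: "i < n\<^sub>\<sigma> \<Longrightarrow> 0 \<in> interior (T i)"
  using scheme by (simp add: multiscale_scheme_def)

lemma finite_rule: "i < n\<^sub>\<sigma> \<Longrightarrow> finite (rule \<sigma> i)"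
  using scheme by (simp add: multiscale_scheme_def)

lemma tessellation_rule: "i < n\<^sub>\<sigma> \<Longrightarrow> tessellation (rule \<sigma> i) (T i)"
  using scheme by (simp add: multiscale_scheme_def)

lemma vol_copy: "i < n\<^sub>\<sigma> \<Longrightarrow> \<alpha> > 0 \<Longrightarrow> vol (place x \<alpha> (T i)) = \<alpha> ^ CARD('d)"
  by (simp add: vol_place vol_T)

lemma tile_copy: "i < n\<^sub>\<sigma> \<Longrightarrow> \<alpha> > 0 \<Longrightarrow> tile (place x \<alpha> (T i))"
  by (simp add: tile_place tile_T)

lemma vol_gt_1_iff: "\<alpha> > 0 \<Longrightarrow> i < n\<^sub>\<sigma> \<Longrightarrow> vol (place x \<alpha> (T i)) > 1 \<longleftrightarrow> \<alpha> > 1"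
  by (simp add: vol_copy power_less_one_iff one_less_power not_le[symmetric] power_le_one_iff)

text \<open>A tile determines its type, position and scale, because distinct prototiles are not copies of each
  other. This makes the substitution of a tile well defined.\<close>
lemma place_T_unique:
  assumes eq: "place x \<alpha> (T i) = place y \<beta> (T j)" and i: "i < n\<^sub>\<sigma>" "j < n\<^sub>\<sigma>" and pos: "\<alpha> > 0" "\<beta> > 0"
  shows "i = j \<and> x = y \<and> \<alpha> = \<beta>"
proof -
  have "i = j"
  proof (rule ccontr)
    assume "i \<noteq> j"
    have "place (- ((1 / \<alpha>) *\<^sub>R x)) (1 / \<alpha>) (place x \<alpha> (T i)) =
        place (- ((1 / \<alpha>) *\<^sub>R x)) (1 / \<alpha>) (place y \<beta> (T j))"
      by (simp add: eq)
    then have "T i = place (- ((1 / \<alpha>) *\<^sub>R x) + (1 / \<alpha>) *\<^sub>R y) (1 / \<alpha> * \<beta>) (T j)"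
      unfolding place_place using pos by simp
    then have "has_type \<sigma> j (T i)" using i pos unfolding has_type_def tile_of_def
      by (metis divide_pos_pos mult_pos_pos zero_less_one)
    then show False using scheme i \<open>i \<noteq> j\<close> by (simp add: multiscale_scheme_def)
  qed
  moreover have "x = y \<and> \<alpha> = \<beta>"
    using place_cancel[OF eq[unfolded \<open>i = j\<close>]] pos tile_T[OF i(2)] by (simp add: tile_def)
  ultimately show ?thesis by simp
qed

lemma substitute_place:
  assumes "i < n\<^sub>\<sigma>" "\<alpha> > 0"
  shows "substitute \<sigma> (place x \<alpha> (T i)) = place x \<alpha> ` rule \<sigma> i"
  using assms place_T_unique unfolding substitute_def by blast

text \<open>The edge lengths of the substitution graph: an edge leads from type \<open>i\<close> to type \<open>k\<close> if a tile of type
  \<open>k\<close> and scale \<open>\<alpha>\<close> occurs in the rule for \<open>i\<close>, and its length \<open>- ln \<alpha>\<close> is the time that the semi-flow needs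
  to inflate that tile to unit volume.\<close>
definition \<Lambda> :: "real set" where
  "\<Lambda> = {l. \<exists>i<n\<^sub>\<sigma>. \<exists>V\<in>rule \<sigma> i. \<exists>k. tile_of \<sigma> k (exp (- l)) V}"

lemma rule_tileE:
  assumes "i < n\<^sub>\<sigma>" "V \<in> rule \<sigma> i"
  obtains k x l where "k < n\<^sub>\<sigma>" "V = place x (exp (- l)) (T k)" "l \<in> \<Lambda>"
proof -
  obtain k \<alpha> where k: "tile_of \<sigma> k \<alpha> V"
    using assms scheme unfolding multiscale_scheme_def by blast
  then have "tile_of \<sigma> k (exp (- (- ln \<alpha>))) V" by (simp add: tile_of_def)
  with assms that show ?thesis unfolding \<Lambda>_def tile_of_def by blast
qed

lemma \<Lambda>_pos:
  assumes "l \<in> \<Lambda>" shows "l > 0"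
proof -
  obtain i V k where V: "i < n\<^sub>\<sigma>" "V \<in> rule \<sigma> i" "tile_of \<sigma> k (exp (- l)) V"
    using assms by (auto simp: \<Lambda>_def)
  obtain j \<alpha> where j: "\<alpha> < 1" "tile_of \<sigma> j \<alpha> V"
    using scheme V unfolding multiscale_scheme_def by blast
  then have "exp (- l) = \<alpha>" using V(3) place_T_unique unfolding tile_of_def by metis
  then show ?thesis using j by (metis exp_less_one_iff neg_less_0_iff_less)
qed

lemma finite_\<Lambda>: "finite \<Lambda>"
proof (rule finite_subset)
  show "\<Lambda> \<subseteq> (\<Union>i<n\<^sub>\<sigma>. (\<lambda>V. - ln (vol V) / CARD('d)) ` rule \<sigma> i)"
  proof
    fix l assume "l \<in> \<Lambda>"
    then obtain i V k where V: "i < n\<^sub>\<sigma>" "V \<in> rule \<sigma> i" "tile_of \<sigma> k (exp (- l)) V"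
      by (auto simp: \<Lambda>_def)
    have "vol V = exp (- l) ^ CARD('d)" using V(3) by (auto simp: tile_of_def vol_copy)
    then have "l = - ln (vol V) / CARD('d)" by (simp add: ln_realpow)
    then show "l \<in> (\<Union>i<n\<^sub>\<sigma>. (\<lambda>V. - ln (vol V) / CARD('d)) ` rule \<sigma> i)" using V by blast
  qed
qed (use finite_rule in auto)

lemma \<Lambda>_lower: obtains l0 where "l0 > 0" "\<And>l. l \<in> \<Lambda> \<Longrightarrow> l0 \<le> l"
proof (cases "\<Lambda> = {}")
  case True
  then show ?thesis using that[of 1] by simp
next
  case False
  then show ?thesis using that[of "Min \<Lambda>"] finite_\<Lambda> \<Lambda>_pos by simp
qed

text \<open>Inserting 0 makes the maximum meaningful if there are no edges.\<close>
definition max_edge :: real where "max_edge = Max (insert 0 \<Lambda>)"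

lemma \<Lambda>_upper: "l \<in> \<Lambda> \<Longrightarrow> l \<le> max_edge" and max_edge_nonneg: "0 \<le> max_edge"
  unfolding max_edge_def using finite_\<Lambda> by auto

text \<open>\<open>path i l j\<close>: a walk of total length \<open>l\<close> from \<open>i\<close> to \<open>j\<close> in the substitution graph.\<close>
inductive path :: "nat \<Rightarrow> real \<Rightarrow> nat \<Rightarrow> bool" for i where
  path_refl: "path i 0 i"
| path_step: "path i l j \<Longrightarrow> V \<in> rule \<sigma> j \<Longrightarrow> k < n\<^sub>\<sigma> \<Longrightarrow> V = place x (exp (- l')) (T k) \<Longrightarrow> l' \<in> \<Lambda> \<Longrightarrow>
    path i (l + l') k"

lemma path_type: "path i l j \<Longrightarrow> i < n\<^sub>\<sigma> \<Longrightarrow> j < n\<^sub>\<sigma>"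
  by (induction rule: path.induct) auto

lemma path_nonneg: "path i l j \<Longrightarrow> 0 \<le> l"
  by (induction rule: path.induct) (auto dest: \<Lambda>_pos)

lemma path_trans: "path j l' k \<Longrightarrow> path i l j \<Longrightarrow> path i (l + l') k"
proof (induction rule: path.induct)
  case (path_step l' j' V k x l'')
  then show ?case using path.path_step[of i "l + l'" j' V k x l''] by (simp add: add.assoc)
qed simp

lemma path_repeat: "path i l i \<Longrightarrow> path i (real n * l) i"
proof (induction n)
  case (Suc n)
  then show ?case using path_trans[of i l i i "real n * l"] by (simp add: algebra_simps)
qed (simp add: path_refl)

text \<open>Substitution along a path of length \<open>l\<close> divides the scale by \<open>e\<^sup>l\<close>. A tile is substituted only if its scale
  exceeds 1, which bounds the scale of its descendants from below.\<close>
lemma stages_path: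
  assumes "S \<in> stages \<sigma> t i" "i < n\<^sub>\<sigma>"
  shows "\<exists>j l x. path i l j \<and> S = place x (exp (t - l)) (T j) \<and> (t \<ge> 0 \<longrightarrow> t - l \<ge> - max_edge)"
  using assms
proof (induction rule: stages.induct)
  case start
  show ?case
    by (rule exI[of _ i], rule exI[of _ 0], rule exI[of _ 0]) (use max_edge_nonneg in \<open>auto simp: path_refl\<close>)
next
  case (subst S U)
  then obtain j l x where j: "path i l j" "S = place x (exp (t - l)) (T j)" by blast
  have jn: "j < n\<^sub>\<sigma>" using path_type j(1) subst.prems by blast
  have "t - l > 0" using subst.hyps(2) jn unfolding j(2) by (simp add: vol_gt_1_iff)
  obtain V where V: "V \<in> rule \<sigma> j" "U = place x (exp (t - l)) V"
    using subst.hyps(3) substitute_place[OF jn, of "exp (t - l)" x] j(2) by auto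
  obtain k y l' where k: "k < n\<^sub>\<sigma>" "V = place y (exp (- l')) (T k)" "l' \<in> \<Lambda>"
    using rule_tileE[OF jn V(1)] .
  have "U = place (x + exp (t - l) *\<^sub>R y) (exp (t - (l + l'))) (T k)"
    unfolding V(2) k(2) place_place by (simp add: exp_add[symmetric] algebra_simps)
  moreover have "path i (l + l') k" using path_step[OF j(1) V(1) k] .
  moreover have "t - (l + l') \<ge> - max_edge" using \<open>t - l > 0\<close> \<Lambda>_upper[OF k(3)] by simp
  ultimately show ?case by blast
qed

text \<open>Self-similarity: an inflated tile \<open>e\<^sup>u T\<^sub>j\<close> that occurs at some stage is substituted further exactly as
  in the construction of \<open>F\<^sub>u(T\<^sub>j)\<close>.\<close>
lemma stages_trans:
  assumes "W \<in> stages \<sigma> u j" "place x (exp u) (T j) \<in> stages \<sigma> t i" "j < n\<^sub>\<sigma>"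
  shows "place x 1 W \<in> stages \<sigma> t i"
  using assms
proof (induction rule: stages.induct)
  case start
  then show ?case by (simp add: place_place)
next
  case (subst S U)
  obtain k l y where k: "path j l k" "S = place y (exp (u - l)) (T k)"
    using stages_path[OF subst.hyps(1)] subst.prems by blast
  have kn: "k < n\<^sub>\<sigma>" using path_type k(1) subst.prems by blast
  obtain V where V: "V \<in> rule \<sigma> k" "U = place y (exp (u - l)) V"
    using subst.hyps(3) substitute_place[OF kn, of "exp (u - l)" y] k(2) by auto
  have "place x 1 U \<in> substitute \<sigma> (place x 1 S)"
    unfolding V(2) k(2) place_place using substitute_place[OF kn, of "exp (u - l)" "x + y"] V(1) by simp
  moreover have "vol (place x 1 S) > 1" using subst.hyps(2) by (simp add: vol_place)
  ultimately show ?case using stages.subst subst by blast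
qed

lemma stages_of_path:
  assumes "path i l j" "i < n\<^sub>\<sigma>" "l \<le> t"
  shows "\<exists>x. place x (exp (t - l)) (T j) \<in> stages \<sigma> t i"
  using assms
proof (induction rule: path.induct)
  case path_refl
  show ?case using stages.start[of t \<sigma> i] by auto
next
  case (path_step l j V k y l')
  have l': "l' > 0" using \<Lambda>_pos path_step by blast
  then obtain x where x: "place x (exp (t - l)) (T j) \<in> stages \<sigma> t i" using path_step by auto
  have jn: "j < n\<^sub>\<sigma>" using path_step path_type by blast
  have "vol (place x (exp (t - l)) (T j)) > 1" using l' path_step.prems jn by (simp add: vol_gt_1_iff)
  moreover have "place x (exp (t - l)) V \<in> substitute \<sigma> (place x (exp (t - l)) (T j))"
    using substitute_place[OF jn] path_step by simp
  ultimately have "place x (exp (t - l)) V \<in> stages \<sigma> t i" using stages.subst x by blast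
  moreover have "place x (exp (t - l)) V = place (x + exp (t - l) *\<^sub>R y) (exp (t - (l + l'))) (T k)"
    unfolding \<open>V = _\<close> place_place by (simp add: exp_add[symmetric] algebra_simps)
  ultimately show ?case by auto
qed

text \<open>Every tile has an ancestor of roughly any prescribed larger scale \<open>e\<^sup>u\<close>: take the first tile of scale at
  most \<open>e\<^sup>u\<close> on the way down to it. Its parent is larger than \<open>e\<^sup>u\<close>, or it is the initial tile and \<open>u = t\<close>.\<close>
lemma stages_of_scale_at_least:
  assumes "i < n\<^sub>\<sigma>" "t \<ge> u" "u \<ge> 0" "S \<in> stages \<sigma> t i" 
    and "S = place x (exp v) (T k)" "k < n\<^sub>\<sigma>" "v \<le> u"
  shows "\<exists>y w j. j < n\<^sub>\<sigma> \<and> place y (exp w) (T j) \<in> stages \<sigma> t i \<and> S \<subseteq> place y (exp w) (T j) \<and>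
           u - max_edge \<le> w \<and> w \<le> u"
  using assms(4-)
proof (induction arbitrary: x v k rule: stages.induct)
  case start
  have "exp t = exp v" 
    using start place_T_unique[of 0 "exp t" i x "exp v" k] assms by simp
  then have "v = t" by simp
  then have "t = u" using assms start by simp
  then show ?case using stages.start[of t \<sigma> i] assms max_edge_nonneg
    by (intro exI[of _ "0::real^'d"] exI[of _ u] exI[of _ i]) auto
next
  case (subst S U)
  obtain j l y where j: "path i l j" "S = place y (exp (t - l)) (T j)"
    using stages_path[OF subst.hyps(1) assms(1)] by blast
  have jn: "j < n\<^sub>\<sigma>" using path_type j(1) assms by blast
  obtain V where V: "V \<in> rule \<sigma> j" "U = place y (exp (t - l)) V"
    using subst.hyps(3) substitute_place[OF jn, of "exp (t - l)" y] j(2) by auto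
  show ?case
  proof (cases "t - l \<le> u")
    case True
    have "V \<subseteq> T j" using tessellation_rule[OF jn] V(1) by (auto simp: tessellation_def)
    then have "U \<subseteq> S" unfolding V(2) j(2) by (rule place_mono)
    then show ?thesis using subst.IH[OF j(2) jn True] by blast
  next
    case False
    obtain k' z l' where k': "k' < n\<^sub>\<sigma>" "V = place z (exp (- l')) (T k')" "l' \<in> \<Lambda>"
      using rule_tileE[OF jn V(1)] .
    have U: "U = place (y + exp (t - l) *\<^sub>R z) (exp (t - (l + l'))) (T k')"
      unfolding V(2) k'(2) place_place by (simp add: exp_add[symmetric] algebra_simps)
    then have "exp v = exp (t - (l + l'))" 
      using subst.prems k' place_T_unique[of _ "exp v" k _ "exp (t - (l + l'))" k'] by simp
    then have "v = t - (l + l')" by simp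
    then have "u - max_edge \<le> v" using False \<Lambda>_upper[OF k'(3)] by simp
    moreover have "U \<in> stages \<sigma> t i" using subst.hyps stages.subst by blast
    ultimately show ?thesis using subst.prems by blast
  qed
qed

section \<open>Patches of the semi-flow\<close>

lemma substitute_translate:
  assumes "S = place x \<alpha> (T j)" "j < n\<^sub>\<sigma>" "\<alpha> > 0"
  shows "substitute \<sigma> (place c 1 S) = place c 1 ` substitute \<sigma> S"
  using assms by (simp add: place_place substitute_place image_image)

lemma stages_after_one_substitution:
  assumes i: "i < n\<^sub>\<sigma>" and t: "t > 0"
    and V: "\<And>V. V \<in> rule \<sigma> i \<Longrightarrow> ty V < n\<^sub>\<sigma> \<and> V = place (ps V) (exp (- el V)) (T (ty V))"
  shows "stages \<sigma> t i = insert (place 0 (exp t) (T i))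
           (\<Union>V\<in>rule \<sigma> i. place (exp t *\<^sub>R ps V) 1 ` stages \<sigma> (t - el V) (ty V))"
    (is "_ = insert ?start ?rest")
proof -
  have child: "place 0 (exp t) V = place (exp t *\<^sub>R ps V) 1 (place 0 (exp (t - el V)) (T (ty V)))"
    if "V \<in> rule \<sigma> i" for V
  proof -
    have "place 0 (exp t) V = place 0 (exp t) (place (ps V) (exp (- el V)) (T (ty V)))" using V[OF that] by simp
    then show ?thesis by (simp add: place_place exp_add[symmetric])
  qed
  have start_vol: "vol ?start > 1" using i t by (simp add: vol_gt_1_iff)
  have start_sub: "substitute \<sigma> ?start = place 0 (exp t) ` rule \<sigma> i"
    using substitute_place i by simp
  show ?thesis
  proof (intro subset_antisym subsetI)
    fix S assume "S \<in> stages \<sigma> t i"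
    then show "S \<in> insert ?start ?rest"
    proof (induction rule: stages.induct)
      case (subst S U)
      from subst.IH show ?case
      proof
        assume "S = ?start"
        then obtain V where "V \<in> rule \<sigma> i" "U = place 0 (exp t) V" using subst.hyps(3) start_sub by auto
        then show ?thesis using child stages.start by fast
      next
        assume "S \<in> ?rest"
        then obtain V S' where S': "V \<in> rule \<sigma> i" "S = place (exp t *\<^sub>R ps V) 1 S'"
          "S' \<in> stages \<sigma> (t - el V) (ty V)" by blast
        obtain j l x where j: "path (ty V) l j" "S' = place x (exp (t - el V - l)) (T j)"
          using stages_path[OF S'(3)] V[OF S'(1)] by blast
        have jn: "j < n\<^sub>\<sigma>" using path_type[OF j(1)] V[OF S'(1)] by blast
        obtain U' where U': "U' \<in> substitute \<sigma> S'" "U = place (exp t *\<^sub>R ps V) 1 U'"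
          using subst.hyps(3) substitute_translate[OF j(2) jn] S'(2) by auto
        have "vol S' > 1" using subst.hyps(2) S'(2) by (simp add: vol_place)
        then have "U' \<in> stages \<sigma> (t - el V) (ty V)" using S'(3) U'(1) stages.subst by blast
        then show ?thesis using S'(1) U'(2) by blast
      qed
    qed simp
  next
    fix S assume "S \<in> insert ?start ?rest"
    then show "S \<in> stages \<sigma> t i"
    proof
      assume "S = ?start"
      then show ?thesis using stages.start by metis
    next
      assume "S \<in> ?rest"
      then obtain V S' where S': "V \<in> rule \<sigma> i" "S = place (exp t *\<^sub>R ps V) 1 S'"
          "S' \<in> stages \<sigma> (t - el V) (ty V)" by blast
      have "place 0 (exp t) V \<in> stages \<sigma> t i"
        using stages.subst[OF stages.start start_vol] start_sub S'(1) by blast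
      then have "place (exp t *\<^sub>R ps V) (exp (t - el V)) (T (ty V)) \<in> stages \<sigma> t i"
        using child[OF S'(1)] by (simp add: place_place)
      then show ?thesis using stages_trans[OF S'(3)] V[OF S'(1)] S'(2) by blast
    qed
  qed
qed

lemma semiflow_nonpos:
  assumes "i < n\<^sub>\<sigma>" "t \<le> 0"
  shows "semiflow \<sigma> t i = {place 0 (exp t) (T i)}"
proof -
  have v: "\<not> vol (place 0 (exp t) (T i)) > 1" using assms vol_gt_1_iff[of "exp t" i] by simp
  have "stages \<sigma> t i \<subseteq> {place 0 (exp t) (T i)}"
  proof
    fix S assume "S \<in> stages \<sigma> t i"
    then show "S \<in> {place 0 (exp t) (T i)}" by (induction rule: stages.induct) (use v in auto)
  qed
  then show ?thesis using v stages.start[of t \<sigma> i] by (auto simp: semiflow_def)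
qed

text \<open>Inflating \<open>T\<^sub>i\<close> and substituting once gives inflated copies of the tiles of the rule for \<open>i\<close>, each of which
  evolves independently with a delay \<open>el V\<close>. This renewal structure is the basis of the inductions below,
  which terminate because the delays are bounded away from 0.\<close>
lemma semiflow_recursion:
  assumes i: "i < n\<^sub>\<sigma>"
  obtains ty ps el where
    "\<forall>V\<in>rule \<sigma> i. ty V < n\<^sub>\<sigma> \<and> el V \<in> \<Lambda> \<and> V = place (ps V) (exp (- el V)) (T (ty V))"
    "(\<forall>t>0. semiflow \<sigma> t i = (\<Union>V\<in>rule \<sigma> i. place (exp t *\<^sub>R ps V) 1 ` semiflow \<sigma> (t - el V) (ty V)))"
proof -
  have "\<forall>V\<in>rule \<sigma> i. \<exists>k x l. k < n\<^sub>\<sigma> \<and> l \<in> \<Lambda> \<and> V = place x (exp (- l)) (T k)"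
    using rule_tileE[OF i] by metis
  then obtain ty ps el where V: "\<forall>V\<in>rule \<sigma> i. ty V < n\<^sub>\<sigma> \<and> el V \<in> \<Lambda> \<and> V = place (ps V) (exp (- el V)) (T (ty V))"
    by metis
  have "semiflow \<sigma> t i = (\<Union>V\<in>rule \<sigma> i. place (exp t *\<^sub>R ps V) 1 ` semiflow \<sigma> (t - el V) (ty V))"
    if t: "t > 0" for t
  proof -
    have "\<not> vol (place 0 (exp t) (T i)) \<le> 1" using i t vol_gt_1_iff[of "exp t" i] by (simp add: not_le)
    moreover have "stages \<sigma> t i = insert (place 0 (exp t) (T i))
           (\<Union>V\<in>rule \<sigma> i. place (exp t *\<^sub>R ps V) 1 ` stages \<sigma> (t - el V) (ty V))"
      using V by (intro stages_after_one_substitution i t) auto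
    ultimately show ?thesis by (auto simp: semiflow_def vol_place)
  qed
  with V that show ?thesis by simp
qed

lemma semiflow_tessellation:
  assumes "i < n\<^sub>\<sigma>"
  shows "finite (semiflow \<sigma> t i) \<and> tessellation (semiflow \<sigma> t i) (place 0 (exp t) (T i))"
proof -
  obtain l0 where l0: "l0 > 0" "\<And>l. l \<in> \<Lambda> \<Longrightarrow> l0 \<le> l" using \<Lambda>_lower by blast
  have "t \<le> real m * l0 \<Longrightarrow> i < n\<^sub>\<sigma> \<Longrightarrow>
      finite (semiflow \<sigma> t i) \<and> tessellation (semiflow \<sigma> t i) (place 0 (exp t) (T i))" for m
  proof (induction m arbitrary: t i)
    case 0
    then show ?case by (simp add: semiflow_nonpos tessellation_def tile_copy)
  next
    case (Suc m)
    show ?case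
    proof (cases "t > 0")
      case False
      then show ?thesis using Suc.prems by (simp add: semiflow_nonpos tessellation_def tile_copy)
    next
      case True
      obtain ty ps el where V: "\<forall>V\<in>rule \<sigma> i. ty V < n\<^sub>\<sigma> \<and> el V \<in> \<Lambda> \<and> V = place (ps V) (exp (- el V)) (T (ty V))"
        and rec: "\<forall>t>0. semiflow \<sigma> t i = (\<Union>V\<in>rule \<sigma> i. place (exp t *\<^sub>R ps V) 1 ` semiflow \<sigma> (t - el V) (ty V))"
        by (rule semiflow_recursion[OF Suc.prems(2)])
      have IH: "finite (semiflow \<sigma> (t - el V) (ty V))"
        "tessellation (semiflow \<sigma> (t - el V) (ty V)) (place 0 (exp (t - el V)) (T (ty V)))"
        if "V \<in> rule \<sigma> i" for V
      proof -
        have "l0 \<le> el V" using V that l0 by blast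
        then have "t - el V \<le> real m * l0" using Suc.prems(1) by (simp add: algebra_simps)
        then show "finite (semiflow \<sigma> (t - el V) (ty V))"
          "tessellation (semiflow \<sigma> (t - el V) (ty V)) (place 0 (exp (t - el V)) (T (ty V)))"
          using Suc.IH V that by auto
      qed
      have piece: "tessellation (place (exp t *\<^sub>R ps V) 1 ` semiflow \<sigma> (t - el V) (ty V)) (place 0 (exp t) V)"
        if "V \<in> rule \<sigma> i" for V
      proof -
        have "place 0 (exp t) V = place 0 (exp t) (place (ps V) (exp (- el V)) (T (ty V)))" using V that by simp
        also have "\<dots> = place (exp t *\<^sub>R ps V) 1 (place 0 (exp (t - el V)) (T (ty V)))"
          by (simp add: place_place exp_add[symmetric])
        finally show ?thesis using tessellation_place[OF IH(2)[OF that], of 1] by simp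
      qed
      have R: "tessellation (rule \<sigma> i) (T i)" using tessellation_rule Suc.prems by blast
      have "tessellation (\<Union>V\<in>rule \<sigma> i. place (exp t *\<^sub>R ps V) 1 ` semiflow \<sigma> (t - el V) (ty V))
          (\<Union>V\<in>rule \<sigma> i. place 0 (exp t) V)"
      proof (rule tessellation_Union(1))
        fix V V' assume VV: "V \<in> rule \<sigma> i" "V' \<in> rule \<sigma> i" "V \<noteq> V'"
        then have "interior V \<inter> interior V' = {}"
          using R unfolding tessellation_def by (blast dest: pairwiseD)
        then show "interior (place 0 (exp t) V) \<inter> interior (place 0 (exp t) V') = {}"
          by (simp add: interior_place place_Int[symmetric])
      qed (rule piece)
      moreover have "(\<Union>V\<in>rule \<sigma> i. place 0 (exp t) V) = place 0 (exp t) (T i)"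
        using R by (simp add: tessellation_def place_UN[symmetric])
      moreover have "semiflow \<sigma> t i = (\<Union>V\<in>rule \<sigma> i. place (exp t *\<^sub>R ps V) 1 ` semiflow \<sigma> (t - el V) (ty V))"
        using rec True by blast
      ultimately show ?thesis
        using IH(1) finite_rule[OF Suc.prems(2)] by simp
    qed
  qed
  moreover obtain m :: nat where "t < real m * l0"
    using reals_Archimedean3[OF l0(1)] by blast
  ultimately show ?thesis using assms less_imp_le by metis
qed

lemma supp_semiflow: "i < n\<^sub>\<sigma> \<Longrightarrow> supp (semiflow \<sigma> t i) = place 0 (exp t) (T i)"
  using semiflow_tessellation[of i t] by (simp add: tessellation_def supp_def)

section \<open>Counting tiles\<close>

definition tile_count :: "nat \<Rightarrow> real \<Rightarrow> real" where
  "tile_count i t = real (card (semiflow \<sigma> t i))"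

lemma tile_count_recursion:
  assumes i: "i < n\<^sub>\<sigma>"
  obtains ty el where "\<forall>V\<in>rule \<sigma> i. ty V < n\<^sub>\<sigma> \<and> el V \<in> \<Lambda>"
    "(\<forall>t>0. tile_count i t = (\<Sum>V\<in>rule \<sigma> i. tile_count (ty V) (t - el V)))"
proof -
  obtain ty ps el where V: "\<forall>V\<in>rule \<sigma> i. ty V < n\<^sub>\<sigma> \<and> el V \<in> \<Lambda> \<and> V = place (ps V) (exp (- el V)) (T (ty V))"
    and rec: "\<forall>t>0. semiflow \<sigma> t i = (\<Union>V\<in>rule \<sigma> i. place (exp t *\<^sub>R ps V) 1 ` semiflow \<sigma> (t - el V) (ty V))"
    by (rule semiflow_recursion[OF i])
  have "tile_count i t = (\<Sum>V\<in>rule \<sigma> i. tile_count (ty V) (t - el V))" if t: "t > 0" for t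
  proof -
    define P where "P V = place (exp t *\<^sub>R ps V) 1 ` semiflow \<sigma> (t - el V) (ty V)" for V
    have tess: "tessellation (P V) (place 0 (exp t) V)" if "V \<in> rule \<sigma> i" for V
    proof -
      have "place 0 (exp t) V = place 0 (exp t) (place (ps V) (exp (- el V)) (T (ty V)))" using V that by simp
      also have "\<dots> = place (exp t *\<^sub>R ps V) 1 (place 0 (exp (t - el V)) (T (ty V)))"
        by (simp add: place_place exp_add[symmetric])
      finally show ?thesis unfolding P_def
        using tessellation_place[of _ "place 0 (exp (t - el V)) (T (ty V))" 1] semiflow_tessellation V that by simp
    qed
    have disj: "P V \<inter> P V' = {}" if "V \<in> rule \<sigma> i" "V' \<in> rule \<sigma> i" "V \<noteq> V'" for V V'
    proof (rule tessellation_Union(2)[where R = "rule \<sigma> i" and U = "place 0 (exp t)" and P = P])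
      fix V V' assume VV: "V \<in> rule \<sigma> i" "V' \<in> rule \<sigma> i" "V \<noteq> V'"
      then have "interior V \<inter> interior V' = {}"
        using tessellation_rule[OF i] unfolding tessellation_def by (blast dest: pairwiseD)
      then show "interior (place 0 (exp t) V) \<inter> interior (place 0 (exp t) V') = {}"
        by (simp add: interior_place place_Int[symmetric])
    qed (use tess that in auto)
    have fin: "finite (P V)" if "V \<in> rule \<sigma> i" for V
      using semiflow_tessellation V that by (simp add: P_def)
    have "semiflow \<sigma> t i = (\<Union>V\<in>rule \<sigma> i. P V)" using rec t unfolding P_def by blast
    then have "card (semiflow \<sigma> t i) = card (\<Union>V\<in>rule \<sigma> i. P V)" by simp
    also have "\<dots> = (\<Sum>V\<in>rule \<sigma> i. card (P V))"
      using fin disj finite_rule[OF i] by (intro card_UN_disjoint) auto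
    also have "\<dots> = (\<Sum>V\<in>rule \<sigma> i. card (semiflow \<sigma> (t - el V) (ty V)))"
    proof (rule sum.cong[OF refl])
      fix V
      have "inj_on (place (exp t *\<^sub>R ps V) 1) A" for A
        by (rule inj_onI) (simp add: place_inj)
      then show "card (P V) = card (semiflow \<sigma> (t - el V) (ty V))" unfolding P_def by (rule card_image)
    qed
    finally show ?thesis by (simp add: tile_count_def)
  qed
  with V that show ?thesis by blast
qed

text \<open>The number of tiles jumps immediately after the times at which a tile has unit volume, and these
  are lengths of paths. Hence the times that matter for the interval \<open>[s, t]\<close> are those in \<open>[s, t)\<close>.\<close>
lemma tile_count_const:
  assumes "i < n\<^sub>\<sigma>" "s \<le> t" "finite_sums \<Lambda> \<inter> {s..<t} = {}"
  shows "tile_count i s = tile_count i t"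
proof -
  obtain l0 where l0: "l0 > 0" "\<And>l. l \<in> \<Lambda> \<Longrightarrow> l0 \<le> l" using \<Lambda>_lower by blast
  have "t \<le> real m * l0 \<Longrightarrow> i < n\<^sub>\<sigma> \<Longrightarrow> s \<le> t \<Longrightarrow> finite_sums \<Lambda> \<inter> {s..<t} = {} \<Longrightarrow>
      tile_count i s = tile_count i t" for m
  proof (induction m arbitrary: s t i)
    case 0
    then show ?case by (simp add: tile_count_def semiflow_nonpos)
  next
    case (Suc m)
    have "0 \<notin> {s..<t}" using Suc.prems(4) finite_sums.zero[of \<Lambda>] by blast
    then consider "t \<le> 0" | "s > 0" by fastforce
    then show ?case
    proof cases
      case 1
      then show ?thesis using Suc.prems by (simp add: tile_count_def semiflow_nonpos)
    next
      case 2
      obtain ty el where V: "\<forall>V\<in>rule \<sigma> i. ty V < n\<^sub>\<sigma> \<and> el V \<in> \<Lambda>"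
        and rec: "\<forall>t>0. tile_count i t = (\<Sum>V\<in>rule \<sigma> i. tile_count (ty V) (t - el V))"
        by (rule tile_count_recursion[OF Suc.prems(2)])
      have "tile_count (ty V) (s - el V) = tile_count (ty V) (t - el V)" if "V \<in> rule \<sigma> i" for V
      proof (rule Suc.IH)
        have l: "el V \<in> \<Lambda>" "ty V < n\<^sub>\<sigma>" using V that by auto
        show "t - el V \<le> real m * l0" using l0(2)[OF l(1)] Suc.prems(1) by (simp add: algebra_simps)
        show "finite_sums \<Lambda> \<inter> {s - el V..<t - el V} = {}"
        proof (rule ccontr)
          assume "finite_sums \<Lambda> \<inter> {s - el V..<t - el V} \<noteq> {}"
          then obtain x where x: "x \<in> finite_sums \<Lambda>" "s - el V \<le> x" "x < t - el V" by auto
          then have "el V + x \<in> finite_sums \<Lambda> \<inter> {s..<t}"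
            using finite_sums_add_left[OF x(1) l(1)] by auto
          then show False using Suc.prems(4) by blast
        qed
      qed (use V that Suc.prems in auto)
      then show ?thesis using rec 2 Suc.prems(3) by simp
    qed
  qed
  moreover obtain m :: nat where "t < real m * l0"
    using reals_Archimedean3[OF l0(1)] by blast
  ultimately show ?thesis using assms less_imp_le by metis
qed

section \<open>Lengths of substitution paths\<close>

lemma path_of_semiflow:
  assumes "S \<in> semiflow \<sigma> t i" "has_type \<sigma> j S" "i < n\<^sub>\<sigma>"
  shows "\<exists>l. path i l j \<and> vol S = exp (t - l) ^ CARD('d)"
proof -
  obtain k l x where k: "path i l k" "S = place x (exp (t - l)) (T k)"
    using assms(1,3) stages_path unfolding semiflow_def by blast
  have kn: "k < n\<^sub>\<sigma>" using path_type k assms by blast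
  obtain \<alpha> y where y: "j < n\<^sub>\<sigma>" "\<alpha> > 0" "S = place y \<alpha> (T j)"
    using assms(2) by (auto simp: has_type_def tile_of_def)
  have "k = j" using place_T_unique[of x "exp (t - l)" k y \<alpha> j] y k(2) kn by simp
  then show ?thesis using k kn by (auto simp: vol_copy)
qed

text \<open>The two unit-volume tiles of incommensurability are closed paths of lengths \<open>t\<^sub>1\<close> and \<open>t\<^sub>2\<close>. By irreducibility
  every type leads to the first one, and the first leads to the second, so that both closed paths can be
  repeated arbitrarily often; the resulting lengths are eventually dense.\<close>
lemma eventually_dense_paths:
  assumes "irreducible_scheme \<sigma>" "incommensurable_scheme \<sigma>"
  obtains i\<^sub>0 where "i\<^sub>0 < n\<^sub>\<sigma>"
    "\<And>\<epsilon>. \<epsilon> > 0 \<Longrightarrow> \<exists>L0. \<forall>L\<ge>L0. \<forall>k<n\<^sub>\<sigma>. \<exists>l. path k l i\<^sub>0 \<and> L < l \<and> l < L + \<epsilon>"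
proof -
  obtain i j t1 t2 S1 S2 where ij: "i < n\<^sub>\<sigma>" "j < n\<^sub>\<sigma>" and t: "t1 > 0" "t2 > 0"
    and irr: "\<not> (\<exists>q\<in>\<rat>. t1 = q * t2)"
    and S1: "S1 \<in> semiflow \<sigma> t1 i" "has_type \<sigma> i S1" "vol S1 = 1"
    and S2: "S2 \<in> semiflow \<sigma> t2 j" "has_type \<sigma> j S2" "vol S2 = 1"
    using assms(2) unfolding incommensurable_scheme_def by (elim exE conjE bexE) (rule that)
  have loop: "path k s k" if S: "S \<in> semiflow \<sigma> s k" "has_type \<sigma> k S" "vol S = 1" and k: "k < n\<^sub>\<sigma>" for S s k
  proof -
    obtain l where l: "path k l k" "vol S = exp (s - l) ^ CARD('d)"
      using path_of_semiflow[OF S(1,2) k] by blast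
    then have "exp (s - l) ^ CARD('d) = 1" using S by simp
    then have "exp (s - l) = 1" using power_eq_1_iff[of "exp (s - l)" "CARD('d)"] by simp
    then show ?thesis using l(1) by simp
  qed
  have p1: "path i t1 i" and p2: "path j t2 j" using loop[OF S1 ij(1)] loop[OF S2 ij(2)] .
  have conn: "\<exists>l. path a l b" if "a < n\<^sub>\<sigma>" "b < n\<^sub>\<sigma>" for a b
  proof -
    obtain t S where "S \<in> semiflow \<sigma> t a" "has_type \<sigma> b S"
      using assms(1) \<open>a < n\<^sub>\<sigma>\<close> \<open>b < n\<^sub>\<sigma>\<close> unfolding irreducible_scheme_def by metis
    then show ?thesis using path_of_semiflow \<open>a < n\<^sub>\<sigma>\<close> by metis
  qed
  obtain q where q: "path i q j" using conn ij by blast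
  have "\<forall>k. \<exists>l. k < n\<^sub>\<sigma> \<longrightarrow> path k l i" using conn ij by blast
  then obtain p where p: "\<And>k. k < n\<^sub>\<sigma> \<Longrightarrow> path k (p k) i" by metis
  show ?thesis
  proof (rule that[OF ij(2)])
    fix \<epsilon> :: real assume "\<epsilon> > 0"
    then obtain L1 where L1: "\<And>L. L \<ge> L1 \<Longrightarrow> \<exists>n m. L < real n * t1 + real m * t2 \<and> real n * t1 + real m * t2 < L + \<epsilon>"
      using integer_combinations_eventually_dense[OF t irr] by blast
    have "\<exists>l. path k l j \<and> L < l \<and> l < L + \<epsilon>"
      if L: "L \<ge> L1 + q + (\<Sum>k<n\<^sub>\<sigma>. p k)" and k: "k < n\<^sub>\<sigma>" for L k
    proof -
      have "p k \<le> (\<Sum>k<n\<^sub>\<sigma>. p k)" using k p path_nonneg by (intro member_le_sum) auto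
      then have "L - q - p k \<ge> L1" using L by simp
      then obtain n m where nm: "L - q - p k < real n * t1 + real m * t2" "real n * t1 + real m * t2 < L - q - p k + \<epsilon>"
        using L1 by blast
      have "path k (p k + (real n * t1 + (q + real m * t2))) j"
        by (intro path_trans[OF _ p[OF k]] path_trans[OF _ path_repeat[OF p1]] path_trans[OF path_repeat[OF p2] q])
      moreover have "L < p k + (real n * t1 + (q + real m * t2))" "p k + (real n * t1 + (q + real m * t2)) < L + \<epsilon>"
        using nm by linarith+
      ultimately show "\<exists>l. path k l j \<and> L < l \<and> l < L + \<epsilon>" by blast
    qed
    then show "\<exists>L0. \<forall>L\<ge>L0. \<forall>k<n\<^sub>\<sigma>. \<exists>l. path k l j \<and> L < l \<and> l < L + \<epsilon>" by blast
  qed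
qed

section \<open>Patches of a tiling and patches of the semi-flow\<close>

lemma prototiles_bounded: obtains M where "M > 0" "\<And>i. i < n\<^sub>\<sigma> \<Longrightarrow> T i \<subseteq> cball 0 M"
proof -
  have "bounded (\<Union>i<n\<^sub>\<sigma>. T i)" using tile_T by (auto simp: tile_def)
  then obtain M where "M > 0" "\<forall>x\<in>(\<Union>i<n\<^sub>\<sigma>. T i). norm x \<le> M" using bounded_pos by blast
  then show ?thesis using that[of M] by (auto simp: subset_iff)
qed

lemma stages_subset: 
  assumes "S \<in> stages \<sigma> t i" "i < n\<^sub>\<sigma>" shows "S \<subseteq> place 0 (exp t) (T i)"
  using assms
proof (induction rule: stages.induct)
  case (subst S U)
  obtain j l x where j: "path i l j" "S = place x (exp (t - l)) (T j)"
    using stages_path[OF subst.hyps(1) subst.prems] by blast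
  have jn: "j < n\<^sub>\<sigma>" using path_type j(1) subst.prems by blast
  obtain V where V: "V \<in> rule \<sigma> j" "U = place x (exp (t - l)) V"
    using subst.hyps(3) substitute_place[OF jn, of "exp (t - l)" x] j(2) by auto
  have "V \<subseteq> T j" using tessellation_rule[OF jn] V(1) by (auto simp: tessellation_def)
  then have "U \<subseteq> S" unfolding V(2) j(2) by (rule place_mono)
  then show ?case using subst by blast
qed simp

lemma semiflow_tile:
  assumes "S \<in> semiflow \<sigma> t i" "i < n\<^sub>\<sigma>" "t \<ge> 0"
  obtains j x u where "j < n\<^sub>\<sigma>" "S = place x (exp u) (T j)" "- max_edge \<le> u" "u \<le> 0"
proof -
  obtain j l x where j: "path i l j" "S = place x (exp (t - l)) (T j)" "t - l \<ge> - max_edge"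
    using assms stages_path[of S t i] unfolding semiflow_def by blast
  have jn: "j < n\<^sub>\<sigma>" using path_type j(1) assms by blast
  have "\<not> vol S > 1" using assms by (simp add: semiflow_def)
  then have "t - l \<le> 0" using vol_gt_1_iff[of "exp (t - l)" j x] jn j(2) by simp
  with that j jn show ?thesis by blast
qed

lemma translated_sub_patchE:
  assumes "A \<in> translated_sub_patches \<sigma>"
  obtains v t i where "t \<ge> 0" "i < n\<^sub>\<sigma>" "A \<subseteq> place v 1 ` semiflow \<sigma> t i"
proof -
  obtain v Q P where "A = (\<lambda>S. (+) v ` S) ` Q" "P \<in> generating_patches \<sigma>" "Q \<in> sub_patches P"
    using assms unfolding translated_sub_patches_def by blast
  moreover then obtain t i where "P = semiflow \<sigma> t i" "t \<ge> 0" "i < n\<^sub>\<sigma>"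
    unfolding generating_patches_def by blast
  ultimately show ?thesis using that[of t i v] by (auto simp: place_translation sub_patches_def)
qed

lemma translated_sub_patch_tile:
  assumes "A \<in> translated_sub_patches \<sigma>" "S \<in> A"
  obtains j x u where "j < n\<^sub>\<sigma>" "S = place x (exp u) (T j)" "- max_edge \<le> u" "u \<le> 0"
proof -
  obtain v t i where t: "t \<ge> 0" "i < n\<^sub>\<sigma>" "A \<subseteq> place v 1 ` semiflow \<sigma> t i"
    using translated_sub_patchE[OF assms(1)] .
  then obtain S' where S': "S' \<in> semiflow \<sigma> t i" "S = place v 1 S'" using assms(2) by blast
  obtain j x u where "j < n\<^sub>\<sigma>" "S' = place x (exp u) (T j)" "- max_edge \<le> u" "u \<le> 0"
    using semiflow_tile[OF S'(1) t(2,1)] .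
  then show ?thesis using that[of j "v + x" u] S'(2) by (simp add: place_place)
qed

text \<open>A tile of the tiling is a limit of tiles of one fixed type and of scale at most 1; since
  the types are remembered, it is itself a copy of that prototile, and the approximating copies converge
  to it.\<close>
lemma limit_tile:
  assumes A: "\<And>k. A k \<in> translated_sub_patches \<sigma>" and b: "\<And>k. b k S \<in> A k"
    and type: "\<And>k j. has_type \<sigma> j (b k S) \<longleftrightarrow> has_type \<sigma> j S"
    and lim: "(\<lambda>k. D (frontier (b k S)) (frontier S)) \<longlonglongrightarrow> 0"
  shows "\<exists>j y \<beta> x \<alpha>. j < n\<^sub>\<sigma> \<and> 0 < \<beta> \<and> \<beta> \<le> 1 \<and> S = place y \<beta> (T j) \<and>
    (\<forall>k. b k S = place (x k) (\<alpha> k) (T j) \<and> 0 < \<alpha> k \<and> \<alpha> k \<le> 1) \<and> x \<longlonglongrightarrow> y \<and> \<alpha> \<longlonglongrightarrow> \<beta>"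
proof -
  have ex: "\<exists>j x u. j < n\<^sub>\<sigma> \<and> b k S = place x (exp u) (T j) \<and> - max_edge \<le> u \<and> u \<le> 0" for k
    using translated_sub_patch_tile[OF A b] by metis
  obtain j x0 u0 where j: "j < n\<^sub>\<sigma>" "b 0 S = place x0 (exp u0) (T j)" using ex by blast
  then have "has_type \<sigma> j (b 0 S)" unfolding has_type_def tile_of_def using exp_gt_zero by blast
  then have hS: "has_type \<sigma> j S" using type by blast
  then obtain y \<beta> where S: "\<beta> > 0" "S = place y \<beta> (T j)" by (auto simp: has_type_def tile_of_def)
  have "\<exists>x u. b k S = place x (exp u) (T j) \<and> - max_edge \<le> u \<and> u \<le> 0" for k
  proof -
    obtain j' x u where j': "j' < n\<^sub>\<sigma>" "b k S = place x (exp u) (T j')" "- max_edge \<le> u" "u \<le> 0" using ex by blast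
    have "has_type \<sigma> j (b k S)" using type hS by blast
    then obtain x' \<alpha>' where "\<alpha>' > 0" "b k S = place x' \<alpha>' (T j)" by (auto simp: has_type_def tile_of_def)
    then have "j' = j" using place_T_unique[of x "exp u" j' x' \<alpha>' j] j' j by simp
    then show ?thesis using j' by blast
  qed
  then obtain x u where u: "\<And>k. b k S = place (x k) (exp (u k)) (T j)" "\<And>k. - max_edge \<le> u k" "\<And>k. u k \<le> 0"
    by metis
  define \<alpha> where "\<alpha> k = exp (u k)" for k
  have bk: "b k S = place (x k) (\<alpha> k) (T j)" and \<alpha>: "0 < \<alpha> k" "\<alpha> k \<le> 1" for k
    using u by (auto simp: \<alpha>_def)
  define K where "K = frontier (T j)"
  have Tb: "bounded (T j)" "0 \<in> interior (T j)" using tile_T[OF j(1)] zero_interior_T[OF j(1)] by (auto simp: tile_def)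
  have K: "compact K" unfolding K_def using Tb by (rule_tac compact_frontier_bounded)
  have fr: "frontier (b k S) = place (x k) (\<alpha> k) K" "frontier S = place y \<beta> K" for k
  proof -
    show "frontier (b k S) = place (x k) (\<alpha> k) K" using \<alpha>(1)[of k] unfolding K_def bk by (simp add: frontier_place)
    show "frontier S = place y \<beta> K" using S(1) unfolding K_def S(2) by (simp add: frontier_place)
  qed
  have Kne: "K \<noteq> {}" using frontier_wide(1)[OF Tb] unfolding K_def by blast
  obtain M where M: "M > 0" "\<And>p. p \<in> K \<Longrightarrow> norm p \<le> M"
    using compact_imp_bounded[OF K] bounded_pos[of K] by blast
  have cpt: "compact (place z a K)" for z a unfolding place_def
    using K by (intro compact_continuous_image continuous_intros)
  have "x \<longlonglongrightarrow> y \<and> \<alpha> \<longlonglongrightarrow> \<beta>"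
  proof (rule homothetic_copies_converge[OF K])
    fix e :: real assume e: "e > 0"
    show "\<forall>\<^sub>F k in sequentially. (\<forall>u\<in>place (x k) (\<alpha> k) K. \<exists>v\<in>place y \<beta> K. dist u v \<le> e) \<and>
        (\<forall>v\<in>place y \<beta> K. \<exists>u\<in>place (x k) (\<alpha> k) K. dist v u \<le> e)"
    proof (rule D_limit_compact)
      show "(\<lambda>k. D (place (x k) (\<alpha> k) K) (place y \<beta> K)) \<longlonglongrightarrow> 0" using lim unfolding fr .
      fix k p q assume "p \<in> place (x k) (\<alpha> k) K" "q \<in> place (x k) (\<alpha> k) K"
      then obtain p' q' where pq: "p' \<in> K" "q' \<in> K" "p = x k + \<alpha> k *\<^sub>R p'" "q = x k + \<alpha> k *\<^sub>R q'"
        by (auto simp: place_def)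
      have "dist p q = \<alpha> k * norm (p' - q')"
        using \<alpha>[of k] unfolding pq dist_norm by (simp add: scaleR_diff_right[symmetric])
      also have "\<dots> \<le> 1 * norm (p' - q')" using \<alpha> by (intro mult_right_mono) auto
      also have "\<dots> \<le> 2 * M" using M(2)[OF pq(1)] M(2)[OF pq(2)] norm_triangle_ineq4[of p' q'] by linarith
      finally show "dist p q \<le> 2 * M" .
    qed (use cpt Kne e in auto)
  qed (use frontier_wide[OF Tb] \<alpha> S(1) in \<open>auto simp: K_def less_imp_le\<close>)
  then have conv: "x \<longlonglongrightarrow> y" "\<alpha> \<longlonglongrightarrow> \<beta>" by auto
  moreover have "\<beta> \<le> 1" by (rule LIMSEQ_le_const2[OF conv(2)]) (use \<alpha> in auto)
  ultimately show ?thesis using j(1) S bk \<alpha> by blast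
qed

lemma tiling_space_tile:
  assumes \<T>: "\<T> \<in> tiling_space \<sigma>" and S: "S \<in> \<T>"
  shows "\<exists>j y \<beta>. j < n\<^sub>\<sigma> \<and> 0 < \<beta> \<and> \<beta> \<le> 1 \<and> S = place y \<beta> (T j)"
proof -
  have "bounded S" using \<T> S by (auto simp: tiling_space_def tiling_def tessellation_def tile_def)
  then have "{S} \<in> sub_patches \<T>" using S by (simp add: sub_patches_def supp_def)
  then obtain A where A: "\<And>k. A k \<in> translated_sub_patches \<sigma>" "patch_limit \<sigma> A {S}"
    using \<T> unfolding tiling_space_def by blast
  obtain b where b: "\<And>k. bij_betw (b k) {S} (A k)" "\<And>k j. has_type \<sigma> j (b k S) \<longleftrightarrow> has_type \<sigma> j S"
    and lim: "\<And>Q. Q \<subseteq> {S} \<Longrightarrow> (\<lambda>k. D (boundary_set (b k ` Q)) (boundary_set Q)) \<longlonglongrightarrow> 0"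
    using A(2) unfolding patch_limit_def by blast
  have "b k S \<in> A k" for k using b(1)[of k] by (auto simp: bij_betw_def)
  moreover have "(\<lambda>k. D (frontier (b k S)) (frontier S)) \<longlonglongrightarrow> 0"
    using lim[of "{S}"] by (simp add: boundary_set_def)
  ultimately show ?thesis using limit_tile[of A b S] A(1) b(2) by blast
qed

lemma copy_diameter:
  assumes "T j \<subseteq> cball 0 M" "0 < \<beta>" "\<beta> \<le> c" "p \<in> place y \<beta> (T j)" "M > 0"
  shows "dist y p \<le> c * M"
proof -
  have "p \<in> cball y (\<beta> * M)" using place_bound[OF assms(1), of \<beta> y] assms by auto
  then have "dist y p \<le> \<beta> * M" by simp
  also have "\<dots> \<le> c * M" using assms by (intro mult_right_mono) auto
  finally show ?thesis .
qed

text \<open>The patch of the tiling near a ball is matched by \<open>g\<close> with tiles of a translated generating patch that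
  are at bounded distance. A tile of the generating patch that lies in the ball but is not matched would
  leave a hole of volume bounded below, whereas the matched tiles cover the ball up to a set of small
  measure. The bound on the volume of the ball forces the generating patch to be large.\<close>
lemma approximating_patch:
  assumes \<T>: "\<T> \<in> tiling_space \<sigma>" and M: "M > 0" "\<And>i. i < n\<^sub>\<sigma> \<Longrightarrow> T i \<subseteq> cball 0 M" and R: "R > 0"
  defines "P \<equiv> {S \<in> \<T>. S \<inter> ball 0 R \<noteq> {}}"
  obtains g v t i where "t \<ge> 0" "i < n\<^sub>\<sigma>" "inj_on g P" "g ` P \<subseteq> place v 1 ` semiflow \<sigma> t i"
    "\<And>S p q. S \<in> P \<Longrightarrow> p \<in> S \<Longrightarrow> q \<in> g S \<Longrightarrow> dist p q \<le> 2 * M + 1"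
    "\<And>U. U \<in> place v 1 ` semiflow \<sigma> t i \<Longrightarrow> U \<subseteq> ball 0 R \<Longrightarrow> U \<in> g ` P"
    "vol (ball 0 R :: (real^'d) set) \<le> exp t ^ CARD('d) + 1"
proof -
  have tilT: "\<And>S. S \<in> \<T> \<Longrightarrow> tile S" "\<Union>\<T> = UNIV"
    using \<T> by (auto simp: tiling_space_def tiling_def tessellation_def)
  have "supp P \<subseteq> cball 0 (R + 2 * M)"
  proof
    fix p assume "p \<in> supp P"
    then obtain S q where S: "S \<in> \<T>" "p \<in> S" "q \<in> S" "q \<in> ball 0 R" by (auto simp: supp_def P_def)
    obtain j y \<beta> where j: "j < n\<^sub>\<sigma>" "0 < \<beta>" "\<beta> \<le> 1" "S = place y \<beta> (T j)"
      using tiling_space_tile[OF \<T> S(1)] by blast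
    have "dist y p \<le> 1 * M" "dist y q \<le> 1 * M" using copy_diameter[OF M(2)[OF j(1)] j(2,3) _ M(1)] j(4) S(2,3) by auto
    moreover have "dist 0 p \<le> dist 0 q + dist y q + dist y p"
      using dist_triangle[of 0 p q] dist_triangle2[of q p y] by (simp add: dist_commute)
    ultimately show "p \<in> cball 0 (R + 2 * M)" using S(4) by simp
  qed
  then have "bounded (supp P)" using bounded_cball bounded_subset by blast
  then have "P \<in> sub_patches \<T>" by (auto simp: sub_patches_def P_def)
  then obtain A where A: "\<And>k. A k \<in> translated_sub_patches \<sigma>" "patch_limit \<sigma> A P"
    using \<T> unfolding tiling_space_def by blast
  obtain b where b: "\<And>k. bij_betw (b k) P (A k)" "\<And>k S j. S \<in> P \<Longrightarrow> has_type \<sigma> j (b k S) \<longleftrightarrow> has_type \<sigma> j S"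
    and lim: "\<And>Q. Q \<subseteq> P \<Longrightarrow> (\<lambda>k. D (boundary_set (b k ` Q)) (boundary_set Q)) \<longlonglongrightarrow> 0"
    using A(2) unfolding patch_limit_def by blast
  have finP: "finite P"
  proof -
    obtain v t i where "t \<ge> 0" "i < n\<^sub>\<sigma>" "A 0 \<subseteq> place v 1 ` semiflow \<sigma> t i"
      using translated_sub_patchE[OF A(1)] .
    then have "finite (A 0)" using semiflow_tessellation[of i t] finite_subset by blast
    then show ?thesis using b(1)[of 0] bij_betw_finite by blast
  qed
  have bA: "b k S \<in> A k" if "S \<in> P" for k S using b(1)[of k] that by (auto simp: bij_betw_def)
  define good where "good S j y \<beta> x \<alpha> \<longleftrightarrow>
      j < n\<^sub>\<sigma> \<and> 0 < \<beta> \<and> \<beta> \<le> 1 \<and> S = place y \<beta> (T j) \<and>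
      (\<forall>k. b k S = place (x k) (\<alpha> k) (T j) \<and> 0 < \<alpha> k \<and> \<alpha> k \<le> 1) \<and> x \<longlonglongrightarrow> y \<and> \<alpha> \<longlonglongrightarrow> \<beta>"
    for S j y \<beta> x \<alpha>
  have "\<forall>S\<in>P. \<exists>j y \<beta> x \<alpha>. good S j y \<beta> x \<alpha>"
  proof
    fix S assume S: "S \<in> P"
    show "\<exists>j y \<beta> x \<alpha>. good S j y \<beta> x \<alpha>" unfolding good_def
    proof (rule limit_tile[of A])
      show "(\<lambda>k. D (frontier (b k S)) (frontier S)) \<longlonglongrightarrow> 0"
        using lim[of "{S}"] S by (simp add: boundary_set_def)
    qed (use A(1) bA[OF S] b(2)[OF S] in auto)
  qed
  then obtain j y \<beta> x \<alpha> where good: "\<And>S. S \<in> P \<Longrightarrow> good S (j S) (y S) (\<beta> S) (x S) (\<alpha> S)"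
    by metis
  have j: "\<And>S. S \<in> P \<Longrightarrow> j S < n\<^sub>\<sigma>" "\<And>S. S \<in> P \<Longrightarrow> 0 < \<beta> S" "\<And>S. S \<in> P \<Longrightarrow> \<beta> S \<le> 1"
      "\<And>S. S \<in> P \<Longrightarrow> S = place (y S) (\<beta> S) (T (j S))"
    and bk: "\<And>S k. S \<in> P \<Longrightarrow> b k S = place (x S k) (\<alpha> S k) (T (j S))"
      "\<And>S k. S \<in> P \<Longrightarrow> 0 < \<alpha> S k" "\<And>S k. S \<in> P \<Longrightarrow> \<alpha> S k \<le> 1"
    and conv: "\<And>S. S \<in> P \<Longrightarrow> x S \<longlonglongrightarrow> y S" "\<And>S. S \<in> P \<Longrightarrow> \<alpha> S \<longlonglongrightarrow> \<beta> S"
    using good unfolding good_def by blast+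
  \<comment> \<open>the least possible volume of a tile of a generating patch\<close>
  define \<epsilon> where "\<epsilon> = exp (- max_edge) ^ CARD('d)"
  have \<epsilon>: "\<epsilon> > 0" "\<epsilon> \<le> 1" using max_edge_nonneg by (auto simp: \<epsilon>_def power_le_one)
  have "(\<lambda>k. vol (ball 0 R - \<Union>(b k ` P))) \<longlonglongrightarrow> 0"
  proof (rule copies_cover_in_measure[OF finP])
    fix p :: "real^'d" assume "p \<in> ball 0 R"
    moreover obtain S where "S \<in> \<T>" "p \<in> S" using tilT(2) by blast
    ultimately show "\<exists>S\<in>P. p \<in> S" unfolding P_def by blast
  next
    fix S k assume S: "S \<in> P"
    have "tile (b k S)" using bk[OF S] j(1)[OF S] by (metis tile_copy)
    then show "b k S \<in> sets lebesgue" by (simp add: tile_def)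
  next
    fix S p assume S: "S \<in> P" and p: "p \<in> interior S"
    then have "p \<in> place (y S) (\<beta> S) (interior (T (j S)))"
      using j(2,4)[OF S] by (metis interior_place less_irrefl)
    then have "(1 / \<beta> S) *\<^sub>R (p - y S) \<in> interior (T (j S))" using j(2)[OF S] by (simp add: mem_place_iff)
    moreover have "(\<lambda>k. (1 / \<alpha> S k) *\<^sub>R (p - x S k)) \<longlonglongrightarrow> (1 / \<beta> S) *\<^sub>R (p - y S)"
      using j(2)[OF S] by (intro tendsto_intros conv S) simp
    ultimately have "\<forall>\<^sub>F k in sequentially. (1 / \<alpha> S k) *\<^sub>R (p - x S k) \<in> interior (T (j S))"
      by (intro topological_tendstoD[OF _ open_interior])
    then show "\<forall>\<^sub>F k in sequentially. p \<in> b k S"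
    proof eventually_elim
      case (elim k)
      then show ?case using bk[OF S, of k] interior_subset by (auto simp: mem_place_iff)
    qed
  qed (use tilT in \<open>auto simp: P_def\<close>)
  then have "\<forall>\<^sub>F k in sequentially. vol (ball 0 R - \<Union>(b k ` P)) < \<epsilon>" using \<epsilon>(1) by (rule order_tendstoD)
  moreover have "\<forall>\<^sub>F k in sequentially. \<forall>S\<in>P. dist (x S k) (y S) < 1"
    using finP conv(1) by (intro eventually_ball_finite ballI tendstoD) auto
  ultimately have "\<forall>\<^sub>F k in sequentially. vol (ball 0 R - \<Union>(b k ` P)) < \<epsilon> \<and> (\<forall>S\<in>P. dist (x S k) (y S) < 1)"
    by (rule eventually_conj)
  then obtain k where k: "vol (ball 0 R - \<Union>(b k ` P)) < \<epsilon>" "\<And>S. S \<in> P \<Longrightarrow> dist (x S k) (y S) < 1"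
    using eventually_happens'[OF sequentially_bot] by blast
  obtain v t i where t: "t \<ge> 0" "i < n\<^sub>\<sigma>" "A k \<subseteq> place v 1 ` semiflow \<sigma> t i"
    using translated_sub_patchE[OF A(1)] .
  let ?F = "place v 1 ` semiflow \<sigma> t i"
  have F: "finite ?F" "tessellation ?F (place v 1 (place 0 (exp t) (T i)))"
    using semiflow_tessellation[OF t(2)] by (auto intro: tessellation_place)
  have sub: "b k ` P \<subseteq> ?F" using b(1)[of k] t(3) by (auto simp: bij_betw_def)
  have lm: "U \<in> lmeasurable" if "U \<in> ?F" for U
    using F(2) that by (auto simp: tessellation_def intro: tile_lmeasurable)
  have Um: "\<Union>(b k ` P) \<in> lmeasurable" using finP sub lm by (intro fmeasurable.finite_Union) auto
  show ?thesis
  proof (rule that[of t i "b k" v])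
    show "inj_on (b k) P" using b(1)[of k] by (simp add: bij_betw_def)
    show "dist p q \<le> 2 * M + 1" if S: "S \<in> P" "p \<in> S" "q \<in> b k S" for S p q
    proof -
      have "p \<in> place (y S) (\<beta> S) (T (j S))" using S j(4) by blast
      then have "dist (y S) p \<le> 1 * M" using copy_diameter[OF M(2)[OF j(1)[OF S(1)]] j(2,3)[OF S(1)] _ M(1)] by blast
      moreover have "dist (x S k) q \<le> 1 * M"
        using copy_diameter[OF M(2)[OF j(1)[OF S(1)]] bk(2,3)[OF S(1)] _ M(1)] S bk(1) by metis
      moreover have "dist p q \<le> dist (y S) p + dist (x S k) (y S) + dist (x S k) q"
        using dist_triangle[of p q "y S"] dist_triangle[of "y S" q "x S k"] by (simp add: dist_commute)
      ultimately show ?thesis using k(2)[OF S(1)] by linarith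
    qed
    show "U \<in> b k ` P" if U: "U \<in> ?F" "U \<subseteq> ball 0 R" for U
    proof (rule ccontr)
      assume n: "U \<notin> b k ` P"
      have null: "U \<inter> \<Union>(b k ` P) \<in> null_sets lebesgue"
        using tile_almost_disjoint_from_rest[OF F(2) sub _ U(1) n] finP by simp
      obtain U' where U': "U' \<in> semiflow \<sigma> t i" "U = place v 1 U'" using U by blast
      obtain a z u where a: "a < n\<^sub>\<sigma>" "U' = place z (exp u) (T a)" "- max_edge \<le> u"
        using semiflow_tile[OF U'(1) t(2,1)] by metis
      have "\<epsilon> \<le> exp u ^ CARD('d)" unfolding \<epsilon>_def using a(3) by (intro power_mono) auto
      also have "\<dots> = vol U" using a by (simp add: U'(2) vol_place vol_T)
      also have "\<dots> = vol (U - (U \<inter> \<Union>(b k ` P)))"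
        using measure_Diff_null_set[OF fmeasurableD[OF lm[OF U(1)]] null] by simp
      also have "\<dots> \<le> vol (ball 0 R - \<Union>(b k ` P))"
        using U(2) lm[OF U(1)] Um null by (intro measure_mono_fmeasurable fmeasurable.Diff) auto
      finally show False using k(1) by simp
    qed
    have "vol (ball 0 R :: (real^'d) set) \<le> vol (\<Union>(b k ` P) \<union> (ball 0 R - \<Union>(b k ` P)))"
      using Um by (intro measure_mono_fmeasurable fmeasurable.Un fmeasurable.Diff) auto
    also have "\<dots> \<le> vol (\<Union>(b k ` P)) + vol (ball 0 R - \<Union>(b k ` P))"
      using Um by (intro measure_Un_le) auto
    also have "vol (\<Union>(b k ` P)) \<le> vol (place v 1 (place 0 (exp t) (T i)))"
    proof (rule measure_mono_fmeasurable)
      have "\<Union>?F = place v 1 (place 0 (exp t) (T i))" using F(2) by (simp add: tessellation_def)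
      then show "\<Union>(b k ` P) \<subseteq> place v 1 (place 0 (exp t) (T i))" using sub by blast
      show "place v 1 (place 0 (exp t) (T i)) \<in> lmeasurable"
        by (intro tile_lmeasurable tile_place tile_T t(2)) auto
    qed (use Um in \<open>auto intro: fmeasurableD\<close>)
    also have "\<dots> = exp t ^ CARD('d)" using t(2) by (simp add: vol_place vol_T)
    finally show "vol (ball 0 R :: (real^'d) set) \<le> exp t ^ CARD('d) + 1" using k(1) \<epsilon>(2) by linarith
  qed (use t sub in auto)
qed

section \<open>Tile counts of a uniformly spread tiling\<close>

text \<open>Go up from \<open>S\<close> to an ancestor of scale about \<open>e\<^sup>u\<close>, then down along a path into type \<open>j\<close> whose length is
  chosen so that the resulting scale is just below \<open>e\<^sup>w\<close>.\<close>
lemma inflated_tile_in_patch: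
  assumes t: "t \<ge> 0" "i < n\<^sub>\<sigma>" and S: "S \<in> semiflow \<sigma> t i" and U: "0 \<le> u" "u \<le> t"
    and paths: "\<And>v k. u - max_edge \<le> v \<Longrightarrow> v \<le> u \<Longrightarrow> k < n\<^sub>\<sigma> \<Longrightarrow> \<exists>l\<le>v. path k l j \<and> w - \<epsilon> < v - l \<and> v - l < w"
    and M: "M > 0" "\<And>i. i < n\<^sub>\<sigma> \<Longrightarrow> T i \<subseteq> cball 0 M"
  shows "\<exists>x w'. w - \<epsilon> < w' \<and> w' < w \<and> place x (exp w') (T j) \<in> stages \<sigma> t i \<and>
           (\<forall>p\<in>place x (exp w') (T j). \<forall>q\<in>S. dist p q \<le> 2 * M * exp u)"
proof -
  obtain k x v where k: "k < n\<^sub>\<sigma>" "S = place x (exp v) (T k)" "v \<le> 0"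
    using semiflow_tile[OF S t(2,1)] by metis
  have Sst: "S \<in> stages \<sigma> t i" using S by (simp add: semiflow_def)
  obtain y v' k' where anc: "k' < n\<^sub>\<sigma>" "place y (exp v') (T k') \<in> stages \<sigma> t i" "S \<subseteq> place y (exp v') (T k')"
    "u - max_edge \<le> v'" "v' \<le> u"
    using stages_of_scale_at_least[OF t(2) U(2,1) Sst k(2,1)] k(3) U(1) by force
  obtain l where l: "l \<le> v'" "path k' l j" "w - \<epsilon> < v' - l" "v' - l < w"
    using paths[OF anc(4,5,1)] by blast
  obtain z where z: "place z (exp (v' - l)) (T j) \<in> stages \<sigma> v' k'"
    using stages_of_path[OF l(2) anc(1) l(1)] by blast
  have in_stages: "place (y + z) (exp (v' - l)) (T j) \<in> stages \<sigma> t i"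
    using stages_trans[OF z anc(2,1)] by (simp add: place_place)
  have "place z (exp (v' - l)) (T j) \<subseteq> place 0 (exp v') (T k')" using stages_subset[OF z anc(1)] .
  then have sub: "place (y + z) (exp (v' - l)) (T j) \<subseteq> place y (exp v') (T k')"
    using place_mono[of "place z (exp (v' - l)) (T j)" "place 0 (exp v') (T k')" y 1] by (simp add: place_place)
  have "dist p q \<le> 2 * M * exp u" if "p \<in> place (y + z) (exp (v' - l)) (T j)" "q \<in> S" for p q
  proof -
    have "p \<in> place y (exp v') (T k')" "q \<in> place y (exp v') (T k')" using that sub anc(3) by auto
    then have "dist y p \<le> exp u * M" "dist y q \<le> exp u * M"
      using copy_diameter[OF M(2)[OF anc(1)], of "exp v'" "exp u" _ y] anc(5) M(1) by auto
    moreover have "dist p q \<le> dist y p + dist y q" by (rule dist_triangle3)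
    ultimately show ?thesis by (simp add: algebra_simps)
  qed
  then show ?thesis using l in_stages by blast
qed

text \<open>Transfer of uniform spreading: the tiles of a copy of \<open>F\<^sub>s(T\<^sub>j)\<close> inside an approximating patch are matched
  with tiles of the tiling, and thereby with lattice points at distance less than \<open>C0 + 2 M + 2\<close>. Conversely, a
  lattice point deep inside the copy belongs to a tile of the tiling whose partner is contained in the support of
  the copy, and hence is one of its tiles.\<close>
lemma count_near_volume:
  assumes \<T>: "\<T> \<in> tiling_space \<sigma>"
    and f: "\<And>S. S \<in> \<T> \<Longrightarrow> f S \<in> S" "inj_on f \<T>"
    and a: "a > 0" and \<phi>: "bij_betw \<phi> (f ` \<T>) (scaled_lattice a)"
    and C0: "C0 \<ge> 0" "\<And>S. S \<in> \<T> \<Longrightarrow> norm (f S - \<phi> (f S)) \<le> C0"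
    and M: "M > 0" "\<And>i. i < n\<^sub>\<sigma> \<Longrightarrow> T i \<subseteq> cball 0 M"
    and j: "j < n\<^sub>\<sigma>"
    and paths: "\<exists>L0. \<forall>L\<ge>L0. \<forall>k<n\<^sub>\<sigma>. \<exists>l. path k l j \<and> L < l \<and> l < L + \<epsilon>"
    and w: "\<epsilon> > 0" "\<epsilon> \<le> w"
  defines "r \<equiv> C0 + 2 * M + 2 + a * CARD('d)"
  shows "\<exists>w'. w - \<epsilon> < w' \<and> w' < w \<and>
    \<bar>tile_count j w' * a ^ CARD('d) - exp w' ^ CARD('d)\<bar>
      \<le> vol (neighborhood r (frontier (place 0 (exp w') (T j))))"
proof -
  obtain L0 where L0: "\<And>L k. L \<ge> L0 \<Longrightarrow> k < n\<^sub>\<sigma> \<Longrightarrow> \<exists>l. path k l j \<and> L < l \<and> l < L + \<epsilon>"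
    using paths by blast
  \<comment> \<open>an ancestor of scale in \<open>[exp (u - max_edge), exp u]\<close> is large enough for dense path lengths\<close>
  define u where "u = max 0 (w + L0) + max_edge"
  have u0: "u \<ge> 0" using max_edge_nonneg by (simp add: u_def)
  have upaths: "\<exists>l\<le>v. path k l j \<and> w - \<epsilon> < v - l \<and> v - l < w"
    if v: "u - max_edge \<le> v" "v \<le> u" and k: "k < n\<^sub>\<sigma>" for v k
  proof -
    have "v - w \<ge> L0" using v(1) by (simp add: u_def)
    then obtain l where "path k l j" "v - w < l" "l < v - w + \<epsilon>" using L0 k by blast
    then show ?thesis using w by (intro exI[of _ l]) auto
  qed
  \<comment> \<open>a tile of scale at most \<open>e\<^sup>u\<close> that meets the surroundings of the origin is far from the boundary of the ball of radius \<open>R1\<close>\<close>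
  define R1 where "R1 = 2 * M * exp u + (2 * M + 1) + C0 + 1"
  have R1: "R1 > 0" using M C0 by (simp add: R1_def add_pos_nonneg)
  obtain R where R: "R > R1" "vol (ball 0 R :: (real^'d) set) > exp u ^ CARD('d) + 1"
  proof -
    define v1 where "v1 = vol (ball 0 1 :: (real^'d) set)"
    have v1: "v1 > 0" unfolding v1_def by (simp add: content_ball_pos)
    have vR: "vol (ball 0 R :: (real^'d) set) = R ^ CARD('d) * v1" if "R > 0" for R
    proof -
      have "ball 0 R = place 0 R (ball (0::real^'d) 1)"
        using that by (auto simp: mem_place_iff pos_divide_less_eq)
      then show ?thesis using that by (simp add: vol_place v1_def)
    qed
    define R where "R = max (R1 + 1) (max 1 ((exp u ^ CARD('d) + 2) / v1))"
    have "R \<ge> 1" "R > R1" by (auto simp: R_def)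
    have "exp u ^ CARD('d) + 2 \<le> R * v1" using v1 by (simp add: R_def pos_divide_le_eq[symmetric])
    also have "R * v1 \<le> R ^ CARD('d) * v1" using \<open>R \<ge> 1\<close> v1 by (intro mult_right_mono self_le_power) auto
    finally show ?thesis using that[of R] \<open>R > R1\<close> vR \<open>R \<ge> 1\<close> by simp
  qed
  define P where "P = {S \<in> \<T>. S \<inter> ball 0 R \<noteq> {}}"
  have R0: "R > 0" using R R1 by linarith
  obtain g v t i where t: "t \<ge> 0" "i < n\<^sub>\<sigma>" and g: "inj_on g P" "g ` P \<subseteq> place v 1 ` semiflow \<sigma> t i"
    and gd: "\<And>S p q. S \<in> P \<Longrightarrow> p \<in> S \<Longrightarrow> q \<in> g S \<Longrightarrow> dist p q \<le> 2 * M + 1"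
    and gs: "\<And>U. U \<in> place v 1 ` semiflow \<sigma> t i \<Longrightarrow> U \<subseteq> ball 0 R \<Longrightarrow> U \<in> g ` P"
    and vR: "vol (ball 0 R :: (real^'d) set) \<le> exp t ^ CARD('d) + 1"
    by (rule approximating_patch[OF \<T> M(1) _ R0], erule M(2), fold P_def) (rule that)
  let ?F = "place v 1 ` semiflow \<sigma> t i"
  have F: "tessellation ?F (place v 1 (place 0 (exp t) (T i)))"
    using semiflow_tessellation[OF t(2)] by (auto intro: tessellation_place)
  have ut: "u \<le> t"
  proof -
    have "exp u ^ CARD('d) \<le> exp t ^ CARD('d)" using vR R(2) by linarith
    then have "exp u \<le> exp t" by (subst (asm) power_mono_iff) auto
    then show ?thesis by simp
  qed
  have \<T>U: "\<Union>\<T> = UNIV" using \<T> by (auto simp: tiling_space_def tiling_def tessellation_def)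
  obtain S0 where S0: "S0 \<in> \<T>" "0 \<in> S0" using \<T>U by blast
  then have S0P: "S0 \<in> P" using R0 by (auto simp: P_def)
  obtain S1 where S1: "S1 \<in> semiflow \<sigma> t i" "g S0 = place v 1 S1" using g(2) S0P by blast
  have "\<exists>x w'. w - \<epsilon> < w' \<and> w' < w \<and> place x (exp w') (T j) \<in> stages \<sigma> t i \<and>
           (\<forall>p\<in>place x (exp w') (T j). \<forall>q\<in>S1. dist p q \<le> 2 * M * exp u)"
    by (rule inflated_tile_in_patch[OF t S1(1) u0 ut upaths M])
  then obtain x w' where w': "w - \<epsilon> < w'" "w' < w" and xst: "place x (exp w') (T j) \<in> stages \<sigma> t i"
    and xd: "\<And>p q. p \<in> place x (exp w') (T j) \<Longrightarrow> q \<in> S1 \<Longrightarrow> dist p q \<le> 2 * M * exp u"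
    by blast
  define \<Omega> where "\<Omega> = place (v + x) (exp w') (T j)"
  define Q where "Q = place (v + x) 1 ` semiflow \<sigma> w' j"
  have Qt: "finite Q" "tessellation Q \<Omega>"
    using semiflow_tessellation[OF j, of w'] tessellation_place[of "semiflow \<sigma> w' j" "place 0 (exp w') (T j)" 1 "v + x"]
    by (auto simp: Q_def \<Omega>_def place_place)
  have QF: "Q \<subseteq> ?F"
  proof
    fix U assume "U \<in> Q"
    then obtain V where V: "V \<in> semiflow \<sigma> w' j" "U = place (v + x) 1 V" by (auto simp: Q_def)
    have "place x 1 V \<in> stages \<sigma> t i"
      using stages_trans[OF _ xst j] V(1) by (simp add: semiflow_def)
    then have "place x 1 V \<in> semiflow \<sigma> t i" using V(1) by (simp add: semiflow_def vol_place)
    then show "U \<in> ?F" using V(2) by (auto simp: place_place intro!: image_eqI[of _ _ "place x 1 V"])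
  qed
  have \<Omega>R: "norm p < R - C0 - 1" if "p \<in> \<Omega>" for p
  proof -
    have "tile S1" using semiflow_tessellation[OF t(2)] S1(1) by (auto simp: tessellation_def)
    then obtain q where q: "q \<in> S1" using tile_interior_nonempty interior_subset by blast
    obtain p' where p': "p' \<in> place x (exp w') (T j)" "p = v + p'"
    proof -
      obtain y where "y \<in> T j" "p = v + x + exp w' *\<^sub>R y" using \<open>p \<in> \<Omega>\<close> by (auto simp: \<Omega>_def place_def)
      then show ?thesis using that[of "x + exp w' *\<^sub>R y"] by (auto simp: place_def add.assoc)
    qed
    have "v + q \<in> g S0" using q by (auto simp: S1(2) place_def)
    then have "dist 0 (v + q) \<le> 2 * M + 1" using gd[OF S0P S0(2)] by simp
    moreover have "dist p (v + q) \<le> 2 * M * exp u" using xd[OF p'(1) q] by (simp add: p'(2) dist_norm)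
    moreover have "dist 0 p \<le> dist 0 (v + q) + dist p (v + q)" by (rule dist_triangle2)
    ultimately show ?thesis using R(1) by (simp add: R1_def)
  qed
  have QgP: "Q \<subseteq> g ` P"
  proof
    fix U assume U: "U \<in> Q"
    then have "U \<subseteq> \<Omega>" using Qt(2) by (auto simp: tessellation_def)
    then have "U \<subseteq> ball 0 R" using \<Omega>R C0(1) by fastforce
    then show "U \<in> g ` P" by (rule gs[OF subsetD[OF QF U]])
  qed
  define h where "h = the_inv_into P g"
  have h: "h U \<in> P" "g (h U) = U" if "U \<in> Q" for U
    using that QgP the_inv_into_into[OF g(1), of U P] f_the_inv_into_f[OF g(1), of U] by (auto simp: h_def)
  have PT: "P \<subseteq> \<T>" by (auto simp: P_def)
  define Z where "Z = (\<lambda>U. \<phi> (f (h U))) ` Q"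
  have cardZ: "real (card Z) = tile_count j w'"
  proof -
    have "inj_on (\<lambda>U. \<phi> (f (h U))) Q"
    proof (rule inj_onI)
      fix U U' assume U: "U \<in> Q" "U' \<in> Q" "\<phi> (f (h U)) = \<phi> (f (h U'))"
      have hT: "h U \<in> \<T>" "h U' \<in> \<T>" using h U PT by auto
      then have "f (h U) = f (h U')" using U(3) \<phi> by (auto simp: bij_betw_def dest: inj_onD)
      then have "h U = h U'" using f(2) hT by (auto dest: inj_onD)
      then show "U = U'" using h U by metis
    qed
    then have "card Z = card Q" unfolding Z_def by (rule card_image)
    moreover have "inj_on (place (v + x) 1) A" for A by (rule inj_onI) (simp add: place_inj)
    then have "card Q = card (semiflow \<sigma> w' j)" unfolding Q_def by (rule card_image)
    ultimately show ?thesis by (simp add: tile_count_def)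
  qed
  have vol\<Omega>: "vol \<Omega> = exp w' ^ CARD('d)" using j by (simp add: \<Omega>_def vol_place vol_T)
  have \<Omega>t: "tile \<Omega>" unfolding \<Omega>_def by (intro tile_place tile_T j) simp
  have "\<bar>real (card Z) * a ^ CARD('d) - vol \<Omega>\<bar> \<le>
      vol (neighborhood ((C0 + 2 * M + 2) + a * CARD('d)) (frontier \<Omega>))"
  proof (rule lattice_point_count[OF a])
    show "bounded \<Omega>" "\<Omega> \<in> sets lebesgue" using \<Omega>t by (auto simp: tile_def)
    show "finite Z" using Qt by (simp add: Z_def)
    show "Z \<subseteq> scaled_lattice a"
      using \<phi> h PT unfolding Z_def bij_betw_def by blast
    show "C0 + 2 * M + 2 > 0" using C0 M by simp
    fix z assume "z \<in> Z"
    then obtain U where U: "U \<in> Q" "z = \<phi> (f (h U))" by (auto simp: Z_def)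
    have hU: "h U \<in> P" "h U \<in> \<T>" "g (h U) = U" using h[OF U(1)] PT by auto
    have "tile U" "U \<subseteq> \<Omega>" using Qt(2) U(1) by (auto simp: tessellation_def)
    then obtain q where q: "q \<in> U" "q \<in> \<Omega>" using tile_interior_nonempty interior_subset by blast
    have "dist (f (h U)) q \<le> 2 * M + 1" using gd[OF hU(1) f(1)[OF hU(2)]] hU(3) q by simp
    moreover have "dist (f (h U)) z \<le> C0" using C0(2)[OF hU(2)] U(2) by (simp add: dist_norm)
    moreover have "dist z q \<le> dist (f (h U)) z + dist (f (h U)) q" by (rule dist_triangle3)
    ultimately show "\<exists>p\<in>\<Omega>. dist z p \<le> C0 + 2 * M + 2" using q(2) by (intro bexI[of _ q]) auto
  next
    fix z assume z: "z \<in> scaled_lattice a" "ball z (C0 + 2 * M + 2) \<subseteq> \<Omega>"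
    then obtain S where S: "S \<in> \<T>" "z = \<phi> (f S)" using \<phi> unfolding bij_betw_def by blast
    have fz: "dist (f S) z \<le> C0" using C0(2)[OF S(1)] S(2) by (simp add: dist_norm)
    have "z \<in> \<Omega>" using z(2) C0 M by auto
    then have "norm z < R - C0 - 1" by (rule \<Omega>R)
    then have "f S \<in> ball 0 R" using fz dist_triangle[of 0 "f S" z] by (simp add: dist_commute)
    then have SP: "S \<in> P" using f(1)[OF S(1)] S(1) unfolding P_def by blast
    have gS\<Omega>: "g S \<subseteq> \<Omega>"
    proof
      fix q assume "q \<in> g S"
      then have "dist (f S) q \<le> 2 * M + 1" using gd[OF SP f(1)[OF S(1)]] by simp
      then have "dist z q < C0 + 2 * M + 2" using fz dist_triangle3[of z q "f S"] by simp
      then show "q \<in> \<Omega>" using z(2) by auto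
    qed
    have gSF: "g S \<in> ?F" using g(2) SP by blast
    have "g S \<in> Q"
    proof (rule ccontr)
      assume "g S \<notin> Q"
      then have "g S \<inter> \<Union>Q \<in> null_sets lebesgue"
        using tile_almost_disjoint_from_rest[OF F QF Qt(1) gSF] by simp
      moreover have "g S \<inter> \<Union>Q = g S" using gS\<Omega> Qt(2) by (auto simp: tessellation_def)
      ultimately have "vol (g S) = 0" by (simp add: measure_def null_sets_def)
      moreover have "vol (g S) > 0" using F gSF by (auto simp: tessellation_def tile_def)
      ultimately show False by simp
    qed
    moreover have "h (g S) = S" unfolding h_def by (rule the_inv_into_f_f[OF g(1) SP])
    ultimately show "z \<in> Z" using S(2) unfolding Z_def by (intro image_eqI[of _ _ "g S"]) auto
  qed
  then have "\<bar>tile_count j w' * a ^ CARD('d) - exp w' ^ CARD('d)\<bar> \<le> vol (neighborhood r (frontier \<Omega>))"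
    unfolding cardZ vol\<Omega> r_def by simp
  moreover have "vol (neighborhood r (frontier \<Omega>)) \<le> vol (neighborhood r (frontier (place 0 (exp w') (T j))))"
  proof -
    have cp: "compact (frontier (place 0 (exp w') (T j)))"
      using tile_T[OF j] by (intro compact_frontier_bounded bounded_place) (simp add: tile_def)
    have r: "r > 0" using C0 M a by (simp add: r_def add_pos_nonneg)
    have "frontier \<Omega> = place (v + x) 1 (frontier (place 0 (exp w') (T j)))"
      by (simp add: \<Omega>_def frontier_place place_place)
    then show ?thesis using neighborhood_place[OF cp, of 1 r "v + x"] r by simp
  qed
  ultimately show ?thesis using w' by (intro exI[of _ w']) linarith
qed

text \<open>Only finitely many jumps lie below \<open>t\<close>, so \<open>N\<^sub>j\<close> is constant on some interval \<open>(\<delta>, t]\<close>, and the estimate passes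
  to the limit along times in this interval.\<close>
lemma left_limit_of_estimate:
  assumes j: "j < n\<^sub>\<sigma>" and t: "t > t1" "t1 \<ge> 0"
    and dense: "\<And>w \<epsilon>. t1 < w - \<epsilon> \<Longrightarrow> \<epsilon> > 0 \<Longrightarrow>
        \<exists>w'. w - \<epsilon> < w' \<and> w' < w \<and> \<bar>tile_count j w' - G w'\<bar> \<le> B w'"
    and cont: "continuous_on UNIV G" "continuous_on UNIV B"
  shows "\<bar>tile_count j t - G t\<bar> \<le> B t"
proof -
  obtain C E where CE: "\<forall>t\<ge>0. finite (finite_sums \<Lambda> \<inter> {..t}) \<and> real (card (finite_sums \<Lambda> \<inter> {..t})) \<le> (C * (1 + t)) ^ E"
    using finite_sums_polynomial_growth[OF finite_\<Lambda> \<Lambda>_pos] by blast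
  have fin: "finite (finite_sums \<Lambda> \<inter> {..t})" using CE t by simp
  define \<delta> where "\<delta> = Max (insert t1 (finite_sums \<Lambda> \<inter> {..<t}))"
  have fin': "finite (finite_sums \<Lambda> \<inter> {..<t})" by (rule finite_subset[OF _ fin]) auto
  have \<delta>: "t1 \<le> \<delta>" "\<delta> < t" using fin' t by (auto simp: \<delta>_def)
  have gap: "tile_count j s = tile_count j t" if "\<delta> < s" "s < t" for s
  proof (rule tile_count_const[OF j])
    show "finite_sums \<Lambda> \<inter> {s..<t} = {}"
    proof (rule ccontr)
      assume "finite_sums \<Lambda> \<inter> {s..<t} \<noteq> {}"
      then obtain x where "x \<in> finite_sums \<Lambda>" "s \<le> x" "x < t" by auto
      then have x: "x \<in> finite_sums \<Lambda> \<inter> {..<t}" "s \<le> x" by auto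
      then have "x \<le> \<delta>" unfolding \<delta>_def using fin' by (intro Max_ge) auto
      then show False using x(2) that(1) by simp
    qed
  qed (use that in simp)
  have "\<exists>w'. t - (t - \<delta>) / (real n + 2) < w' \<and> w' < t \<and> \<bar>tile_count j w' - G w'\<bar> \<le> B w'" for n :: nat
  proof (rule dense)
    have "(t - \<delta>) / (real n + 2) < t - \<delta>" using \<delta> by (simp add: pos_divide_less_eq)
    then show "t1 < t - (t - \<delta>) / (real n + 2)" using \<delta> by linarith
    show "(t - \<delta>) / (real n + 2) > 0" using \<delta> by simp
  qed
  then obtain W where W: "\<And>n::nat. t - (t - \<delta>) / (real n + 2) < W n" "\<And>n. W n < t"
      "\<And>n. \<bar>tile_count j (W n) - G (W n)\<bar> \<le> B (W n)"
    by metis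
  have lim: "W \<longlonglongrightarrow> t"
  proof (rule tendsto_sandwich)
    show "(\<lambda>n. t - (t - \<delta>) / (real n + 2)) \<longlonglongrightarrow> t" by real_asymp
  qed (use W in \<open>auto intro!: always_eventually less_imp_le\<close>)
  have "\<delta> < W n" for n
  proof -
    have "(t - \<delta>) / (real n + 2) \<le> t - \<delta>" using \<delta> by (simp add: pos_divide_le_eq)
    then show ?thesis using W(1)[of n] by linarith
  qed
  then have "\<bar>tile_count j t - G (W n)\<bar> \<le> B (W n)" for n using W(2,3)[of n] gap by simp
  moreover have "(\<lambda>n. \<bar>tile_count j t - G (W n)\<bar>) \<longlonglongrightarrow> \<bar>tile_count j t - G t\<bar>"
    using cont(1) lim by (intro tendsto_intros continuous_on_tendsto_compose[OF cont(1) lim]) auto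
  moreover have "(\<lambda>n. B (W n)) \<longlonglongrightarrow> B t"
    by (intro continuous_on_tendsto_compose[OF cont(2) lim]) auto
  ultimately show ?thesis by (intro LIMSEQ_le[of _ _ "\<lambda>n. B (W n)"]) auto
qed

text \<open>The neighbourhoods in \<open>count_near_volume\<close> have some fixed radius \<open>r\<close> instead of 1. Scaling by \<open>r\<close> turns them into
  1-neighbourhoods of the boundary of \<open>e\<^sup>s T\<^sub>j\<close> with \<open>s = w - ln r\<close>, which only changes the constant.\<close>
lemma tiling_not_uniformly_spread:
  assumes irr: "irreducible_scheme \<sigma>" and inc: "incommensurable_scheme \<sigma>" and \<eta>: "\<eta> > 0"
    and bound: "\<forall>i<n\<^sub>\<sigma>. (\<lambda>t. vol (neighborhood 1 (frontier (supp (semiflow \<sigma> t i)))))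
             \<in> O[at_top](\<lambda>t. exp ((real CARD('d) - \<eta>) * t))"
    and \<T>: "\<T> \<in> tiling_space \<sigma>"
  shows "\<not> uniformly_spread_tiling \<T>"
proof
  assume "uniformly_spread_tiling \<T>"
  then obtain f a \<phi> where f: "\<And>S. S \<in> \<T> \<Longrightarrow> f S \<in> S" "inj_on f \<T>" and a: "a > 0"
    and \<phi>: "bij_betw \<phi> (f ` \<T>) (scaled_lattice a)"
    and bdd: "bdd_above ((\<lambda>y. norm (y - \<phi> y)) ` (f ` \<T>))"
    unfolding uniformly_spread_tiling_def uniformly_spread_def by blast
  obtain C where C: "\<And>S. S \<in> \<T> \<Longrightarrow> norm (f S - \<phi> (f S)) \<le> C" using bdd by (auto simp: bdd_above_def)
  define C0 where "C0 = max C 0"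
  have C0: "C0 \<ge> 0" "\<And>S. S \<in> \<T> \<Longrightarrow> norm (f S - \<phi> (f S)) \<le> C0" using C by (auto simp: C0_def intro: max.coboundedI1)
  obtain M where M: "M > 0" "\<And>i. i < n\<^sub>\<sigma> \<Longrightarrow> T i \<subseteq> cball 0 M" using prototiles_bounded by blast
  obtain j where j: "j < n\<^sub>\<sigma>"
    and paths: "\<And>\<epsilon>. \<epsilon> > 0 \<Longrightarrow> \<exists>L0. \<forall>L\<ge>L0. \<forall>k<n\<^sub>\<sigma>. \<exists>l. path k l j \<and> L < l \<and> l < L + \<epsilon>"
    using eventually_dense_paths[OF irr inc] by blast
  define r where "r = C0 + 2 * M + 2 + a * CARD('d)"
  have r: "r > 0" using C0 M a by (simp add: r_def add_pos_nonneg)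
  define d where "d = real CARD('d)"
  have d: "d > 0" by (simp add: d_def)
  have expd: "exp s ^ CARD('d) = exp (d * s)" for s :: real
    by (simp add: d_def exp_of_nat_mult)
  obtain K t0 where K: "\<And>t. t \<ge> t0 \<Longrightarrow> vol (neighborhood 1 (frontier (supp (semiflow \<sigma> t j)))) \<le> K * exp ((d - \<eta>) * t)"
    and K0: "K \<ge> 0"
  proof -
    have "(\<lambda>t. vol (neighborhood 1 (frontier (supp (semiflow \<sigma> t j))))) \<in> O[at_top](\<lambda>t. exp ((d - \<eta>) * t))"
      using bound j by (simp add: d_def)
    then obtain c where c: "c > 0" and ev: "\<forall>\<^sub>F t in at_top. norm (vol (neighborhood 1 (frontier (supp (semiflow \<sigma> t j))))) \<le> c * norm (exp ((d - \<eta>) * t))"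
      by (rule landau_o.bigE)
    from ev obtain t0 where "\<And>t. t \<ge> t0 \<Longrightarrow> vol (neighborhood 1 (frontier (supp (semiflow \<sigma> t j)))) \<le> c * exp ((d - \<eta>) * t)"
      unfolding eventually_at_top_linorder by auto
    then show ?thesis using that[of t0 c] c by simp
  qed
  define c where "c = 1 / a ^ CARD('d)"
  have c: "c > 0" using a by (simp add: c_def)
  define K' where "K' = c * (exp (d * ln r) * (K * exp (- (d - \<eta>) * ln r)))"
  define t1 where "t1 = max 0 (t0 + ln r)"
  have small: "c * vol (neighborhood r (frontier (place 0 (exp w) (T j)))) \<le> K' * exp ((d - \<eta>) * w)"
    if w: "w \<ge> t1" for w
  proof -
    have cp: "compact (frontier (place 0 (exp (w - ln r)) (T j)))"
      using tile_T[OF j] by (intro compact_frontier_bounded bounded_place) (simp add: tile_def)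
    have "place 0 r (place 0 (exp (w - ln r)) (T j)) = place 0 (exp w) (T j)"
      using r by (simp add: place_place exp_diff)
    then have "frontier (place 0 (exp w) (T j)) = place 0 r (frontier (place 0 (exp (w - ln r)) (T j)))"
      using r by (metis frontier_place less_irrefl)
    then have "vol (neighborhood r (frontier (place 0 (exp w) (T j)))) \<le>
        r ^ CARD('d) * vol (neighborhood 1 (frontier (place 0 (exp (w - ln r)) (T j))))"
      using neighborhood_place[OF cp r, of 1 0] by simp
    also have "\<dots> \<le> r ^ CARD('d) * (K * exp ((d - \<eta>) * (w - ln r)))"
      using K[of "w - ln r"] w r unfolding supp_semiflow[OF j] by (intro mult_left_mono) (auto simp: t1_def)
    also have "r ^ CARD('d) = exp (d * ln r)" using r expd[of "ln r"] by simp
    also have "exp ((d - \<eta>) * (w - ln r)) = exp (- (d - \<eta>) * ln r) * exp ((d - \<eta>) * w)"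
      by (simp add: exp_add[symmetric] algebra_simps)
    finally have "c * vol (neighborhood r (frontier (place 0 (exp w) (T j)))) \<le>
        c * (exp (d * ln r) * (K * (exp (- (d - \<eta>) * ln r) * exp ((d - \<eta>) * w))))"
      using c by (intro mult_left_mono) auto
    then show ?thesis by (simp add: K'_def mult_ac)
  qed
  have estimate: "\<bar>tile_count j t - c * exp (d * t)\<bar> \<le> K' * exp ((d - \<eta>) * t)" if "t \<ge> t1 + 1" for t
  proof (rule left_limit_of_estimate[OF j, of t1])
    show "t > t1" "t1 \<ge> 0" using that by (auto simp: t1_def)
    fix w \<epsilon> assume w: "t1 < w - \<epsilon>" "(\<epsilon>::real) > 0"
    then have "\<epsilon> \<le> w" by (simp add: t1_def)
    then obtain w' where w': "w - \<epsilon> < w'" "w' < w"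
      "\<bar>tile_count j w' * a ^ CARD('d) - exp w' ^ CARD('d)\<bar> \<le> vol (neighborhood r (frontier (place 0 (exp w') (T j))))"
      using count_near_volume[OF \<T> f a \<phi> C0 M j paths[OF w(2)] w(2)] unfolding r_def by blast
    have "tile_count j w' - c * exp (d * w') = c * (tile_count j w' * a ^ CARD('d) - exp w' ^ CARD('d))"
      using a by (simp add: c_def expd field_simps)
    then have "\<bar>tile_count j w' - c * exp (d * w')\<bar> = c * \<bar>tile_count j w' * a ^ CARD('d) - exp w' ^ CARD('d)\<bar>"
      using c by (simp add: abs_mult)
    also have "\<dots> \<le> c * vol (neighborhood r (frontier (place 0 (exp w') (T j))))"
      using w'(3) c by (intro mult_left_mono) auto
    also have "\<dots> \<le> K' * exp ((d - \<eta>) * w')" using w' w by (intro small) simp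
    finally show "\<exists>w'. w - \<epsilon> < w' \<and> w' < w \<and> \<bar>tile_count j w' - c * exp (d * w')\<bar> \<le> K' * exp ((d - \<eta>) * w')"
      using w' by blast
  qed (intro continuous_intros)+
  obtain C E where CE: "\<forall>t\<ge>0. finite (finite_sums \<Lambda> \<inter> {..t}) \<and> real (card (finite_sums \<Lambda> \<inter> {..t})) \<le> (C * (1 + t)) ^ E"
    using finite_sums_polynomial_growth[OF finite_\<Lambda> \<Lambda>_pos] by blast
  show False
    by (rule sparse_jumps_force_large_error[where J = "finite_sums \<Lambda>" and N = "tile_count j", OF _ _ estimate c d \<eta>])
      (use tile_count_const[OF j] CE in auto)
qed

end

theorem theorem8p2:
  fixes \<sigma> :: "('d::finite) scheme" and \<eta> :: real
  assumes "multiscale_scheme \<sigma>" and "normalized \<sigma>"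
    and "irreducible_scheme \<sigma>" and "incommensurable_scheme \<sigma>"
    and "\<eta> > 0"
    and "\<forall>i<num_types \<sigma>.
           (\<lambda>t. vol (neighborhood 1 (frontier (supp (semiflow \<sigma> t i)))))
             \<in> O[at_top](\<lambda>t. exp ((real CARD('d) - \<eta>) * t))"
  shows "\<forall>\<T>\<in>tiling_space \<sigma>. \<not> uniformly_spread_tiling \<T>"
proof
  interpret normalized_scheme \<sigma> using assms(1,2) by unfold_locales
  fix \<T> assume "\<T> \<in> tiling_space \<sigma>"
  then show "\<not> uniformly_spread_tiling \<T>"
    by (rule tiling_not_uniformly_spread[OF assms(3-6)])
qed

end
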